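(* Let $\ell\in\mathbb{N}_0$ denote the level, and let $\mathcal{A}_\ell$ be the affine parameter-dependent operator with blocks $A_\ell(p)=A_\ell^{(0)}+\sum_{\nu=1}^d p^{(\nu)}A_\ell^{(\nu)}$, $p\in\mathcal{I}$, where $A_\ell(p)$ is symmetric positive definite for every $p\in\mathcal{I}$. Let $\mathcal{D}_\ell=\mathrm{diag}(\mathcal{A}_\ell)$ and let $\sigma(\mathcal{D}_\ell)\subseteq[a,b]$ for some $0<a<b\le\infty$. Let $L_\nu=1$ for all $\nu\in\{0,\dots,d\}$, i.e. for each $\nu\in\{1,\dots,d\}$ one has $\mathrm{diag}(A_\ell^{(\nu)})=c_\nu\,\widetilde{\mathrm{Id}}_\nu$ with $c_\nu>0$ and a diagonal matrix $\widetilde{\mathrm{Id}}_\nu$ with entries in $\{0,1\}$ (while $L_0=1$ holds by convention). Let $k\in\mathbb{N}$ and let $\alpha_m,\beta_m>0$ $(m=1,\dots,k)$ be the weights of the exponential sum approximation on $[a,b]$. Then the iteration matrix of the approximate damped Jacobi method, given by $$\mathcal{S}_{\mathrm{approxJac},k,\omega,\ell}:=\mathrm{Id}-\omega\,E_k^*(\mathcal{D}_\ell)\,\mathcal{A}_\ell,$$ fulfills the smoothing property for any damping parameter $\omega\in(0,\omega_0)$, with $$\omega_0=\frac{1}{\rho\left(E_k^*(\mathcal{D}_\ell)\,\mathcal{A}_\ell\right)}.$$ Here the smoothing property means: with $S_\ell(p)$ the block of $\mathcal{S}_{\mathrm{approxJac},k,\omega,\ell}$ belonging to $p$, $$\lVert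 A_\ell(p)S_\ell^\nu(p)\rVert_2\le\eta(\nu)\,\lVert A_\ell(p)\rVert_2$$ for all $0\le\nu\le\overline{\nu}(h_\ell)$, all $p\in\mathcal{I}$ and all levels $\ell\in\mathbb{N}_0$, with functions $\eta$ and $\overline{\nu}$, independent of the level $\ell$, satisfying $\lim_{\nu\to\infty}\eta(\nu)=0$ and ($\lim_{h\to0}\overline{\nu}(h)=\infty$ or $\overline{\nu}(h)=\infty$).
   Context: The levels $\ell\in\mathbb{N}_0$ correspond to grids with grid sizes $h_\ell>0$. $\mathcal{I}=\mathcal{I}_1\times\dots\times\mathcal{I}_d$ with finite sets of real parameter values $\mathcal{I}_\nu=\{p^{(\nu)}(1),\dots,p^{(\nu)}(n_\nu)\}$; $A_\ell^{(0)},\dots,A_\ell^{(d)}$ are parameter-independent square matrices of common size $n_0\times n_0$ (the number $n_0$ of unknowns depends on the level). The operator $$\mathcal{A}_\ell=\mathrm{Id}_{n_d}\otimes\dots\otimes\mathrm{Id}_{n_1}\otimes A_\ell^{(0)}+\sum_{\nu=1}^d \mathrm{Id}_{n_d}\otimes\dots\otimes\mathrm{diag}\left(p^{(\nu)}(1),\dots,p^{(\nu)}(n_\nu)\right)\otimes\dots\otimes\mathrm{Id}_{n_1}\otimes A_\ell^{(\nu)}$$ (with the diagonal matrix in the position of $\mathrm{Id}_{n_\nu}$) is block diagonal with diagonal blocks $A_\ell(p)$, $p\in\mathcal{I}$. $\mathrm{diag}(\cdot)$ of a matrix is its diagonal part, $\sigma(\cdot)$ the spectrum, $\rho(\cdot)$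 the spectral radius, $\lVert\cdot\rVert_2$ the spectral norm. If $b=\infty$, $[a,b]$ means $[a,\infty)$. Exponential sums: for $R=b/a\in(1,\infty]$ let $\alpha_{m,[1,R]},\beta_{m,[1,R]}>0$, $m=1,\dots,k$, be weights for which $x\mapsto\sum_{m=1}^k\alpha_{m,[1,R]}\exp(-\beta_{m,[1,R]}x)$ minimizes $\sup_{x\in[1,R]}\left|\frac1x-E_k(x)\right|$ among all exponential sums $E_k(x)=\sum_{m=1}^k\alpha_m\exp(-\beta_m x)$ with positive weights. The weights on $[a,b]$ are $\alpha_m=\alpha_{m,[1,R]}/a$, $\beta_m=\beta_{m,[1,R]}/a$, and for a diagonal matrix $D$, $E_k^*(D)=\sum_{m=1}^k\alpha_m\exp(-\beta_m D)$ (matrix exponential).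
   Formalization: If b = ∞, the formal statement additionally assumes that the spectra of D_ℓ are bounded above by one constant for all levels ℓ; without this no level-independent η exists in general (e.g. A_ℓ(1) = diag(1, t_ℓ) with t_ℓ → ∞, h_ℓ → 0). *)

theory Defs
  imports
    "Jordan_Normal_Form.Spectral_Radius"
    "HOL-Library.Extended_Real"
    "HOL-Library.Extended_Nat"
begin

text \<open>
  Matrices are those of \<open>Jordan_Normal_Form\<close>, because the number of unknowns varies with the level.
\<close>

section \<open>Matrix notions\<close>

definition vec_norm2 :: "real vec \<Rightarrow> real" where
  "vec_norm2 v = sqrt (v \<bullet> v)"

text \<open>The spectral norm, i.e. the matrix norm induced by the Euclidean vector norm.\<close>

definition spectral_norm :: "real mat \<Rightarrow> real" where
  "spectral_norm A =
     (SUP v \<in> {v \<in> carrier_vec (dim_col A). v \<noteq> 0\<^sub>v (dim_col A)}. vec_norm2 (A *\<^sub>v v) / vec_norm2 v)"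

text \<open>
  Spectrum and spectral radius of a real matrix refer to its complex eigenvalues
  (\<open>E\<^sub>k\<^sup>*(\<D>) \<A>\<close> need not be symmetric).
\<close>

definition real_spectrum :: "real mat \<Rightarrow> complex set" where
  "real_spectrum A = spectrum (map_mat complex_of_real A)"

definition real_spectral_radius :: "real mat \<Rightarrow> real" where
  "real_spectral_radius A = spectral_radius (map_mat complex_of_real A)"

definition sym_pos_def :: "nat \<Rightarrow> real mat \<Rightarrow> bool" where
  "sym_pos_def n A \<longleftrightarrow> A \<in> carrier_mat n n \<and> transpose_mat A = A \<and>
     (\<forall>v \<in> carrier_vec n. v \<noteq> 0\<^sub>v n \<longrightarrow> v \<bullet> (A *\<^sub>v v) > 0)"

definition diag_part :: "real mat \<Rightarrow> real mat" where
  "diag_part A = mat_diag (dim_row A) (\<lambda>i. A $$ (i, i))"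

text \<open>Finite sums of matrices of known size, formed entrywise (matrices are no monoid type class).\<close>

definition mat_sum :: "nat \<Rightarrow> ('i \<Rightarrow> real mat) \<Rightarrow> 'i set \<Rightarrow> real mat" where
  "mat_sum n F I = mat n n (\<lambda>(r, c). \<Sum>i\<in>I. F i $$ (r, c))"

definition mat_exp :: "real mat \<Rightarrow> real mat" where
  "mat_exp A = mat (dim_row A) (dim_row A) (\<lambda>(r, c). \<Sum>j. (A ^\<^sub>m j) $$ (r, c) / fact j)"

definition kronecker :: "real mat \<Rightarrow> real mat \<Rightarrow> real mat" where
  "kronecker A B = mat (dim_row A * dim_row B) (dim_col A * dim_col B)
     (\<lambda>(r, c). A $$ (r div dim_row B, c div dim_col B) * B $$ (r mod dim_row B, c mod dim_col B))"

text \<open>\<open>kronecker_chain F j M\<close> is \<open>F j \<otimes> \<dots> \<otimes> F 1 \<otimes> M\<close>.\<close>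

fun kronecker_chain :: "(nat \<Rightarrow> real mat) \<Rightarrow> nat \<Rightarrow> real mat \<Rightarrow> real mat" where
  "kronecker_chain F 0 M = M"
| "kronecker_chain F (Suc j) M = kronecker (F (Suc j)) (kronecker_chain F j M)"

section \<open>The parameter-dependent operator and its blocks\<close>

text \<open>
  The \<open>\<nu>\<close>-th parameter (\<open>1 \<le> \<nu> \<le> d\<close>) takes the values \<open>p \<nu> 0, \<dots>, p \<nu> (n \<nu> - 1)\<close>, numbered from 0
  as matrix rows are. A point of the parameter set is addressed by its multi-index \<open>i\<close>;
  the point itself is \<open>\<lambda>\<nu>. p \<nu> (i \<nu>)\<close>. \<open>A \<nu>\<close> are the matrices at one level.
\<close>

definition param_indices :: "nat \<Rightarrow> (nat \<Rightarrow> nat) \<Rightarrow> (nat \<Rightarrow> nat) set" where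
  "param_indices d n = PiE {1..d} (\<lambda>\<nu>. {..<n \<nu>})"

definition affine_at :: "nat \<Rightarrow> nat \<Rightarrow> (nat \<Rightarrow> real mat) \<Rightarrow> (nat \<Rightarrow> real) \<Rightarrow> real mat" where
  "affine_at d n0 A x = A 0 + mat_sum n0 (\<lambda>\<nu>. x \<nu> \<cdot>\<^sub>m A \<nu>) {1..d}"

definition affine_operator ::
  "nat \<Rightarrow> (nat \<Rightarrow> nat) \<Rightarrow> (nat \<Rightarrow> nat \<Rightarrow> real) \<Rightarrow> nat \<Rightarrow> (nat \<Rightarrow> real mat) \<Rightarrow> real mat" where
  "affine_operator d n p n0 A =
     kronecker_chain (\<lambda>\<mu>. 1\<^sub>m (n \<mu>)) d (A 0) +
     mat_sum ((\<Prod>\<mu>=1..d. n \<mu>) * n0)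
       (\<lambda>\<nu>. kronecker_chain (\<lambda>\<mu>. if \<mu> = \<nu> then mat_diag (n \<nu>) (p \<nu>) else 1\<^sub>m (n \<mu>)) d (A \<nu>)) {1..d}"

text \<open>
  The diagonal block belonging to \<open>i\<close>: in \<open>\<dots> \<otimes> Id\<^bsub>n\<^sub>1\<^esub> \<otimes> A\<close> the parameter 1 varies fastest among
  the parameters, and \<open>d\<close> slowest.
\<close>

definition block_number :: "nat \<Rightarrow> (nat \<Rightarrow> nat) \<Rightarrow> (nat \<Rightarrow> nat) \<Rightarrow> nat" where
  "block_number d n i = (\<Sum>\<nu>=1..d. i \<nu> * (\<Prod>\<mu>=1..<\<nu>. n \<mu>))"

definition param_block ::
  "nat \<Rightarrow> (nat \<Rightarrow> nat) \<Rightarrow> nat \<Rightarrow> real mat \<Rightarrow> (nat \<Rightarrow> nat) \<Rightarrow> real mat" where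
  "param_block d n n0 M i =
     mat n0 n0 (\<lambda>(r, c). M $$ (block_number d n i * n0 + r, block_number d n i * n0 + c))"

section \<open>Exponential sums\<close>

text \<open>\<open>[a, b]\<close>, to be read as \<open>[a, \<infinity>)\<close> if \<open>b = \<infinity>\<close>.\<close>

definition interval_upto :: "real \<Rightarrow> ereal \<Rightarrow> real set" where
  "interval_upto a b = {x. a \<le> x \<and> ereal x \<le> b}"

definition exp_sum :: "nat \<Rightarrow> (nat \<Rightarrow> real) \<Rightarrow> (nat \<Rightarrow> real) \<Rightarrow> real \<Rightarrow> real" where
  "exp_sum k \<alpha> \<beta> x = (\<Sum>m=1..k. \<alpha> m * exp (- \<beta> m * x))"

definition pos_weights :: "nat \<Rightarrow> (nat \<Rightarrow> real) \<Rightarrow> (nat \<Rightarrow> real) \<Rightarrow> bool" where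
  "pos_weights k \<alpha> \<beta> \<longleftrightarrow> (\<forall>m\<in>{1..k}. \<alpha> m > 0 \<and> \<beta> m > 0)"

text \<open>The supremum is finite for positive weights, since the error is bounded on \<open>[1, \<infinity>)\<close>.\<close>

definition exp_sum_error :: "nat \<Rightarrow> ereal \<Rightarrow> (nat \<Rightarrow> real) \<Rightarrow> (nat \<Rightarrow> real) \<Rightarrow> real" where
  "exp_sum_error k R \<alpha> \<beta> = (SUP x \<in> interval_upto 1 R. \<bar>1 / x - exp_sum k \<alpha> \<beta> x\<bar>)"

definition best_exp_sum :: "nat \<Rightarrow> ereal \<Rightarrow> (nat \<Rightarrow> real) \<Rightarrow> (nat \<Rightarrow> real) \<Rightarrow> bool" where
  "best_exp_sum k R \<alpha> \<beta> \<longleftrightarrow> pos_weights k \<alpha> \<beta> \<and>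
     (\<forall>\<alpha>' \<beta>'. pos_weights k \<alpha>' \<beta>' \<longrightarrow> exp_sum_error k R \<alpha> \<beta> \<le> exp_sum_error k R \<alpha>' \<beta>')"

text \<open>The weights of the exponential sum approximation on \<open>[a, b]\<close>: those on \<open>[1, b/a]\<close>, divided by \<open>a\<close>.\<close>

definition exp_sum_weights ::
  "nat \<Rightarrow> real \<Rightarrow> ereal \<Rightarrow> (nat \<Rightarrow> real) \<Rightarrow> (nat \<Rightarrow> real) \<Rightarrow> bool" where
  "exp_sum_weights k a b \<alpha> \<beta> \<longleftrightarrow>
     (\<exists>\<alpha>1 \<beta>1. best_exp_sum k (b / ereal a) \<alpha>1 \<beta>1 \<and>
        (\<forall>m\<in>{1..k}. \<alpha> m = \<alpha>1 m / a \<and> \<beta> m = \<beta>1 m / a))"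

definition exp_sum_mat :: "nat \<Rightarrow> (nat \<Rightarrow> real) \<Rightarrow> (nat \<Rightarrow> real) \<Rightarrow> real mat \<Rightarrow> real mat" where
  "exp_sum_mat k \<alpha> \<beta> D = mat_sum (dim_row D) (\<lambda>m. \<alpha> m \<cdot>\<^sub>m mat_exp ((- \<beta> m) \<cdot>\<^sub>m D)) {1..k}"

section \<open>Approximate Jacobi method and smoothing property\<close>

definition approx_jacobi ::
  "nat \<Rightarrow> (nat \<Rightarrow> real) \<Rightarrow> (nat \<Rightarrow> real) \<Rightarrow> real \<Rightarrow> real mat \<Rightarrow> real mat" where
  "approx_jacobi k \<alpha> \<beta> \<omega> M = 1\<^sub>m (dim_row M) - \<omega> \<cdot>\<^sub>m (exp_sum_mat k \<alpha> \<beta> (diag_part M) * M)"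

definition damping_bound :: "nat \<Rightarrow> (nat \<Rightarrow> real) \<Rightarrow> (nat \<Rightarrow> real) \<Rightarrow> real mat \<Rightarrow> real" where
  "damping_bound k \<alpha> \<beta> M = 1 / real_spectral_radius (exp_sum_mat k \<alpha> \<beta> (diag_part M) * M)"

text \<open>
  \<open>A l i\<close> and \<open>S l i\<close> are the system and iteration matrices at level \<open>l\<close> for the parameter with index
  \<open>i \<in> I\<close>, and \<open>h l\<close> is the grid size. Both \<open>\<eta>\<close> and \<open>\<nu>max\<close> are chosen before the level.
\<close>

definition smoothing_property ::
  "(nat \<Rightarrow> real) \<Rightarrow> 'i set \<Rightarrow> (nat \<Rightarrow> 'i \<Rightarrow> real mat) \<Rightarrow> (nat \<Rightarrow> 'i \<Rightarrow> real mat) \<Rightarrow> bool" where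
  "smoothing_property h I A S \<longleftrightarrow>
     (\<exists>(\<eta> :: nat \<Rightarrow> real) (\<nu>max :: real \<Rightarrow> enat).
        \<eta> \<longlonglongrightarrow> 0 \<and>
        ((\<nu>max \<longlongrightarrow> \<infinity>) (at_right 0) \<or> (\<forall>x>0. \<nu>max x = \<infinity>)) \<and>
        (\<forall>l. \<forall>i\<in>I. \<forall>\<nu>. enat \<nu> \<le> \<nu>max (h l) \<longrightarrow>
           spectral_norm (A l i * S l i ^\<^sub>m \<nu>) \<le> \<eta> \<nu> * spectral_norm (A l i)))"

end

(* Conjugating with the square root V of the positive diagonal matrix E_k(D) turns each block of
   omega * E_k(D) * A into a symmetric positive definite matrix X = omega * V * A * V, similar to that
   block. As omega * rho < 1, the powers of X are bounded, which for symmetric X forces X <= 1. Then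
   X * (1 - X)^j is positive semidefinite and decreasing in j, and these matrices sum to at most 1, so
   X * (1 - X)^m <= 1 / (m + 1). Undoing the conjugation costs a factor 1 / (omega * w0), where w0 > 0
   bounds the weights E_k(D) from below on all levels; this needs the diagonal entries to be uniformly
   bounded above. Finally the norm of A(p) is at least its diagonal entries, hence at least a, so
   eta(m) = 1 / (w0 * omega * a * (m + 1)) works without restriction on m. *)

theory Submission
  imports Defs "HOL-Analysis.L2_Norm"
begin

text \<open>The obstacle is a mismatch: the condition on \<open>\<omega>\<close> concerns complex
  eigenvalues of a nonsymmetric matrix for the whole operator, whereas the conclusion concerns
  Euclidean norms of real symmetric blocks. Boundedness of the powers bridges the two without
  diagonalizing anything. It follows from a spectral radius below 1, and it survives the passage
  from complex to real entries, to a diagonal block, and to a conjugate matrix; only then is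
  symmetry available to turn it into a contraction. The bound on the powers may depend on the level,
  as may the dimension factors picked up on the way. This does no harm, because it enters only
  through the qualitative statement \<open>X \<le> 1\<close>. The quantitative part is pure
  quadratic-form calculus, and its constants are \<open>w0\<close>, \<open>\<omega>\<close> and
  \<open>a\<close>, which all levels share.\<close>

lemma cauchy_schwarz_vec:
  fixes u v :: "real vec"
  assumes "u \<in> carrier_vec n" "v \<in> carrier_vec n"
  shows "(u \<bullet> v)\<^sup>2 \<le> (u \<bullet> u) * (v \<bullet> v)"
proof -
  let ?N = "{0..<n}"
  have "\<bar>u \<bullet> v\<bar> \<le> (\<Sum>i\<in>?N. \<bar>u $ i\<bar> * \<bar>v $ i\<bar>)"
    using assms sum_abs[of "\<lambda>i. u $ i * v $ i" ?N] by (simp add: scalar_prod_def abs_mult)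
  also have "\<dots> \<le> L2_set (\<lambda>i. u $ i) ?N * L2_set (\<lambda>i. v $ i) ?N"
    by (rule L2_set_mult_ineq)
  finally have "\<bar>u \<bullet> v\<bar>\<^sup>2 \<le> (L2_set (\<lambda>i. u $ i) ?N * L2_set (\<lambda>i. v $ i) ?N)\<^sup>2"
    by (intro power_mono) auto
  moreover have "(L2_set (\<lambda>i. w $ i) ?N)\<^sup>2 = w \<bullet> w" if "w \<in> carrier_vec n" for w :: "real vec"
    using that by (simp add: L2_set_def scalar_prod_def sum_nonneg power2_eq_square)
  ultimately show ?thesis using assms by (simp add: power_mult_distrib)
qed

lemma scalar_prod_self_nonneg: "0 \<le> (v :: real vec) \<bullet> v"
  by (simp add: scalar_prod_def sum_nonneg)

lemma scalar_prod_self_pos: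
  fixes v :: "real vec"
  assumes "v \<in> carrier_vec n" "v \<noteq> 0\<^sub>v n"
  shows "0 < v \<bullet> v"
proof -
  obtain i where i: "i < n" "v $ i \<noteq> 0" using assms by (auto simp: vec_eq_iff)
  have "0 < (\<Sum>j\<in>{0..<n}. v $ j * v $ j)"
    by (rule sum_pos2[of _ i]) (use i in \<open>auto simp: zero_less_mult_iff linorder_neq_iff\<close>)
  then show ?thesis using assms by (simp add: scalar_prod_def)
qed

section \<open>Powers of symmetric contractions\<close>

text \<open>Symmetry is kept as a separate hypothesis, so that products such as \<open>X Y^j\<close>
  can be handled through their quadratic form alone.\<close>

definition pos_semidef :: "nat \<Rightarrow> real mat \<Rightarrow> bool" where
  "pos_semidef n A \<longleftrightarrow> (\<forall>v \<in> carrier_vec n. 0 \<le> v \<bullet> (A *\<^sub>v v))"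

lemma pos_semidefD: "pos_semidef n A \<Longrightarrow> v \<in> carrier_vec n \<Longrightarrow> 0 \<le> v \<bullet> (A *\<^sub>v v)"
  by (simp add: pos_semidef_def)

lemma symmetric_scalar_prod:
  fixes A :: "real mat"
  assumes "A \<in> carrier_mat n n" "transpose_mat A = A" "u \<in> carrier_vec n" "v \<in> carrier_vec n"
  shows "u \<bullet> (A *\<^sub>v v) = (A *\<^sub>v u) \<bullet> v"
  using transpose_vec_mult_scalar[OF assms(1,4,3)] assms by simp

lemma scalar_prod_minus_mult_mat_vec:
  fixes A :: "'a :: ring mat"
  assumes "A \<in> carrier_mat nr nc" "B \<in> carrier_mat nr nc" "u \<in> carrier_vec nr" "v \<in> carrier_vec nc"
  shows "u \<bullet> ((A - B) *\<^sub>v v) = u \<bullet> (A *\<^sub>v v) - u \<bullet> (B *\<^sub>v v)"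
  unfolding minus_mult_distrib_mat_vec[OF assms(1,2,4)]
  by (rule scalar_prod_minus_distrib) (use assms in auto)

text \<open>\<open>pow_mat\<close> appends its new factor on the right; the instance
  \<open>B = Y\<close> serves to move that factor to the left.\<close>

lemma commute_pow_mat:
  assumes "B \<in> carrier_mat n n" "Y \<in> carrier_mat n n" "B * Y = Y * B"
  shows "B * Y ^\<^sub>m j = Y ^\<^sub>m j * B"
proof (induction j)
  case (Suc j)
  have "B * (Y ^\<^sub>m j * Y) = (B * Y ^\<^sub>m j) * Y"
    by (rule assoc_mult_mat[symmetric]) (use assms in auto)
  also have "\<dots> = Y ^\<^sub>m j * (B * Y)"
    unfolding Suc by (rule assoc_mult_mat) (use assms in auto)
  also have "\<dots> = (Y ^\<^sub>m j * Y) * B"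
    unfolding assms(3) by (rule assoc_mult_mat[symmetric]) (use assms in auto)
  finally show ?case by simp
qed (use assms in auto)

text \<open>Since everything commutes, \<open>B Y^(j+2) = Y (B Y^j) Y\<close>, and by symmetry of
  \<open>Y\<close> its form at \<open>v\<close> is the form of \<open>B Y^j\<close> at
  \<open>Y v\<close>. Hence the induction in steps of two, with both \<open>B\<close> and
  \<open>B Y\<close> as base cases.\<close>

lemma pos_semidef_mult_pow:
  fixes B Y :: "real mat"
  assumes B: "B \<in> carrier_mat n n" and Y: "Y \<in> carrier_mat n n" "transpose_mat Y = Y"
    and comm: "B * Y = Y * B"
    and psd: "pos_semidef n B" "pos_semidef n (B * Y)"
  shows "pos_semidef n (B * Y ^\<^sub>m j)"
proof (induction j rule: induct_nat_012)
  case 0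
  then show ?case using B Y psd by simp
next
  case 1
  then show ?case using B Y psd by simp
next
  case (ge2 j)
  show ?case unfolding pos_semidef_def
  proof
    fix v :: "real vec" assume v: "v \<in> carrier_vec n"
    have C: "Y ^\<^sub>m j \<in> carrier_mat n n" "B * Y ^\<^sub>m j \<in> carrier_mat n n" using B Y by auto
    have "Y * Y ^\<^sub>m j = Y ^\<^sub>m j * Y" by (rule commute_pow_mat) (use Y in auto)
    then have "B * Y ^\<^sub>m Suc (Suc j) = B * ((Y * Y ^\<^sub>m j) * Y)" by simp
    also have "\<dots> = (B * Y) * (Y ^\<^sub>m j * Y)"
      using assoc_mult_mat[OF B Y(1), of "Y ^\<^sub>m j * Y" n] assoc_mult_mat[OF Y(1) C(1) Y(1)] C Y B
      by (metis mult_carrier_mat)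
    also have "\<dots> = Y * ((B * Y ^\<^sub>m j) * Y)"
      unfolding comm using assoc_mult_mat[OF Y(1) B, of "Y ^\<^sub>m j * Y" n]
        assoc_mult_mat[OF B C(1) Y(1)] C Y B by (metis mult_carrier_mat)
    finally have "(B * Y ^\<^sub>m Suc (Suc j)) *\<^sub>v v = Y *\<^sub>v ((B * Y ^\<^sub>m j) *\<^sub>v (Y *\<^sub>v v))"
      by (simp only: assoc_mult_mat_vec[OF Y(1) mult_carrier_mat[OF C(2) Y(1)] v]
          assoc_mult_mat_vec[OF C(2) Y(1) v])
    then have "v \<bullet> ((B * Y ^\<^sub>m Suc (Suc j)) *\<^sub>v v) = (Y *\<^sub>v v) \<bullet> ((B * Y ^\<^sub>m j) *\<^sub>v (Y *\<^sub>v v))"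
      using symmetric_scalar_prod[OF Y(1,2) v, of "(B * Y ^\<^sub>m j) *\<^sub>v (Y *\<^sub>v v)"] v C Y
      by (simp del: pow_mat.simps)
    then show "0 \<le> v \<bullet> ((B * Y ^\<^sub>m Suc (Suc j)) *\<^sub>v v)"
      using ge2(1) Y v by (simp add: pos_semidef_def del: pow_mat.simps)
  qed
qed

text \<open>With \<open>Y = 1 - X\<close>, this rests on \<open>X Y = X Y X + Y X Y\<close>.\<close>

lemma pos_semidef_contraction:
  fixes X :: "real mat"
  assumes X: "X \<in> carrier_mat n n" "transpose_mat X = X" and psd: "pos_semidef n X"
    and le: "\<And>v. v \<in> carrier_vec n \<Longrightarrow> v \<bullet> (X *\<^sub>v v) \<le> v \<bullet> v"
    and v: "v \<in> carrier_vec n"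
  shows "(X *\<^sub>v v) \<bullet> (X *\<^sub>v v) \<le> v \<bullet> (X *\<^sub>v v)"
proof -
  define w where "w = X *\<^sub>v v"
  have w: "w \<in> carrier_vec n" "X *\<^sub>v w \<in> carrier_vec n" using X v by (auto simp: w_def)
  \<comment> \<open>This is the form of \<open>Y X Y\<close> at \<open>v\<close>. The form of
    \<open>X Y X\<close> at \<open>v\<close> is \<open>w \<bullet> w - w \<bullet> (X w)\<close>,
    whose sign is the last fact used below.\<close>
  have "(v - w) \<bullet> (X *\<^sub>v (v - w)) = v \<bullet> w - v \<bullet> (X *\<^sub>v w) - w \<bullet> w + w \<bullet> (X *\<^sub>v w)"
    using X v w by (simp add: mult_minus_distrib_mat_vec[of _ n n] w_def[symmetric]
        scalar_prod_minus_distrib[of _ n] minus_scalar_prod_distrib[of _ n])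
  moreover have "v \<bullet> (X *\<^sub>v w) = w \<bullet> w"
    using symmetric_scalar_prod[OF X v w(1)] by (simp add: w_def)
  moreover have "0 \<le> (v - w) \<bullet> (X *\<^sub>v (v - w))" using psd v w by (simp add: pos_semidefD)
  moreover have "w \<bullet> (X *\<^sub>v w) \<le> w \<bullet> w" using le w by simp
  ultimately show ?thesis by (simp add: w_def)
qed

section \<open>From bounded powers to contraction\<close>

text \<open>A crude estimate suffices: the right-hand side depends on \<open>B\<close> only through
  the entrywise bound \<open>c\<close>, so it is uniform over all powers of a power-bounded
  matrix.\<close>

lemma mat_vec_bounded:
  fixes B :: "real mat"
  assumes B: "B \<in> carrier_mat n n" and c: "norm_bound B c" and v: "v \<in> carrier_vec n"
  shows "(B *\<^sub>v v) \<bullet> (B *\<^sub>v v) \<le> real n * (c * (\<Sum>j<n. \<bar>v $ j\<bar>))\<^sup>2"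
proof -
  have "\<bar>(B *\<^sub>v v) $ i\<bar> \<le> c * (\<Sum>j<n. \<bar>v $ j\<bar>)" if i: "i < n" for i
  proof -
    have "(B *\<^sub>v v) $ i = (\<Sum>j<n. B $$ (i, j) * v $ j)"
      using i B v by (simp add: scalar_prod_def lessThan_atLeast0)
    also have "\<bar>\<dots>\<bar> \<le> (\<Sum>j<n. \<bar>B $$ (i, j) * v $ j\<bar>)" by (rule sum_abs)
    also have "\<dots> \<le> (\<Sum>j<n. c * \<bar>v $ j\<bar>)"
      using c i B by (intro sum_mono) (auto simp: norm_bound_def abs_mult intro!: mult_right_mono)
    finally show ?thesis by (simp add: sum_distrib_left)
  qed
  then have "((B *\<^sub>v v) $ i)\<^sup>2 \<le> (c * (\<Sum>j<n. \<bar>v $ j\<bar>))\<^sup>2" if "i < n" for i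
    using that power_mono[OF _ abs_ge_zero, of "(B *\<^sub>v v) $ i" _ 2] by simp
  then have "(\<Sum>i<n. ((B *\<^sub>v v) $ i)\<^sup>2) \<le> (\<Sum>i<n. (c * (\<Sum>j<n. \<bar>v $ j\<bar>))\<^sup>2)"
    by (intro sum_mono) simp
  moreover have "(B *\<^sub>v v) \<bullet> (B *\<^sub>v v) = (\<Sum>i<n. ((B *\<^sub>v v) $ i)\<^sup>2)"
    using B by (simp add: scalar_prod_def[of _ "B *\<^sub>v v"] lessThan_atLeast0 power2_eq_square
        del: index_mult_mat_vec)
  ultimately show ?thesis by simp
qed

text \<open>By Cauchy-Schwarz, \<open>k \<mapsto> \<bar>X\<^sup>k v\<bar>\<^sup>2\<close> is log-convex, so it is unbounded as soon as its first step
  increases.\<close>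

lemma symmetric_power_bounded_contraction:
  fixes X :: "real mat"
  assumes X: "X \<in> carrier_mat n n" "transpose_mat X = X"
    and c: "\<And>k. norm_bound (X ^\<^sub>m k) c"
    and v: "v \<in> carrier_vec n"
  shows "(X *\<^sub>v v) \<bullet> (X *\<^sub>v v) \<le> v \<bullet> v"
proof (rule ccontr)
  define x where "x k = X ^\<^sub>m k *\<^sub>v v" for k
  define s where "s k = x k \<bullet> x k" for k
  have carr: "x k \<in> carrier_vec n" for k
    unfolding x_def by (rule mult_mat_vec_carrier[OF _ v]) (use X in simp)
  have x_Suc: "x (Suc k) = X *\<^sub>v x k" for k
    using X v commute_pow_mat[OF X(1) X(1) refl, of k]
    by (simp add: x_def flip: assoc_mult_mat_vec[of X n n _ n])
  have logconv: "(s (Suc k))\<^sup>2 \<le> s k * s (Suc (Suc k))" for k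
  proof -
    \<comment> \<open>Symmetry moves one factor \<open>X\<close> across the scalar product, which
      makes this term an inner product of its two neighbours.\<close>
    have "s (Suc k) = x k \<bullet> x (Suc (Suc k))"
      unfolding s_def x_Suc using symmetric_scalar_prod[OF X carr[of k], of "X *\<^sub>v x k"] carr[of k] X by simp
    then show ?thesis using cauchy_schwarz_vec[OF carr[of k] carr[of "Suc (Suc k)"]] by (simp add: s_def)
  qed
  assume "\<not> ?thesis"
  then have less: "s 0 < s 1" using X v x_Suc[of 0] by (simp add: s_def x_def)
  have s0: "0 < s 0"
  proof -
    \<comment> \<open>If \<open>s 0\<close> vanished, log-convexity would force
      \<open>s 1 = 0\<close>, against \<open>s 0 < s 1\<close>.\<close>
    have "s 0 \<noteq> 0" using logconv[of 0] less scalar_prod_self_nonneg[of "x 0"] by (auto simp: s_def)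
    then show ?thesis using scalar_prod_self_nonneg[of "x 0"] by (simp add: s_def)
  qed
  \<comment> \<open>Log-convexity means that the ratios of successive terms do not decrease, so the
    first ratio bounds all of them from below and \<open>s\<close> grows at least
    geometrically.\<close>
  define q where "q = s 1 / s 0"
  have q: "1 < q" using less s0 by (simp add: q_def)
  have grow: "0 < s k \<and> q * s k \<le> s (Suc k)" for k
  proof (induction k)
    case 0
    then show ?case using s0 by (simp add: q_def)
  next
    case (Suc k)
    have pos: "0 < s (Suc k)" using Suc q by (smt (verit) mult_pos_pos)
    have "(q * s (Suc k)) * s k \<le> s (Suc k) * s (Suc k)"
      using Suc pos by (simp add: mult.commute mult.left_commute)
    also have "\<dots> \<le> s (Suc (Suc k)) * s k" using logconv[of k] by (simp add: power2_eq_square mult.commute)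
    finally show ?case using Suc pos by simp
  qed
  have "q ^ k * s 0 \<le> s k" for k
  proof (induction k)
    case (Suc k)
    have "q ^ Suc k * s 0 = q * (q ^ k * s 0)" by simp
    also have "\<dots> \<le> q * s k" using Suc q by simp
    finally show ?case using grow[of k] by linarith
  qed simp
  moreover have "s k \<le> real n * (c * (\<Sum>j<n. \<bar>v $ j\<bar>))\<^sup>2" for k
    unfolding s_def x_def by (rule mat_vec_bounded) (use X c v in auto)
  ultimately have "q ^ k \<le> (real n * (c * (\<Sum>j<n. \<bar>v $ j\<bar>))\<^sup>2) / s 0" for k
    using s0 by (smt (verit, best) le_divide_eq)
  then show False using real_arch_pow[OF q] by (meson not_le)
qed

lemma scalar_prod_mult_le_self:
  fixes X :: "real mat"
  assumes X: "X \<in> carrier_mat n n" and v: "v \<in> carrier_vec n"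
    and le: "(X *\<^sub>v v) \<bullet> (X *\<^sub>v v) \<le> v \<bullet> v"
  shows "v \<bullet> (X *\<^sub>v v) \<le> v \<bullet> v"
proof -
  have "(v \<bullet> (X *\<^sub>v v))\<^sup>2 \<le> (v \<bullet> v) * ((X *\<^sub>v v) \<bullet> (X *\<^sub>v v))"
    by (rule cauchy_schwarz_vec) (use X v in auto)
  also have "\<dots> \<le> (v \<bullet> v)\<^sup>2"
    unfolding power2_eq_square by (rule mult_left_mono[OF le scalar_prod_self_nonneg])
  finally show ?thesis using power2_le_imp_le scalar_prod_self_nonneg by blast
qed

section \<open>The smoothing estimate for forms and for norms\<close>

text \<open>Two identities carry the estimate. \<open>X Y^j = Y^j - Y^(j+1)\<close> makes the sum
  over \<open>j < i\<close> telescope to \<open>1 - Y^i\<close>, and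
  \<open>X Y^j - X Y^(j+1) = X^2 Y^j\<close> shows that the summands decrease.\<close>

lemma smoothing_quadratic_form:
  fixes X :: "real mat"
  defines "Y \<equiv> 1\<^sub>m (dim_row X) - X"
  assumes X: "X \<in> carrier_mat n n" "transpose_mat X = X" and psd: "pos_semidef n X"
    and le: "\<And>v. v \<in> carrier_vec n \<Longrightarrow> v \<bullet> (X *\<^sub>v v) \<le> v \<bullet> v"
    and v: "v \<in> carrier_vec n"
  shows "0 \<le> v \<bullet> (X * Y ^\<^sub>m m *\<^sub>v v)" and "real (Suc m) * (v \<bullet> (X * Y ^\<^sub>m m *\<^sub>v v)) \<le> v \<bullet> v"
proof -
  have Y: "Y \<in> carrier_mat n n" "transpose_mat Y = Y"
    using X by (auto simp: Y_def transpose_minus[of _ n n])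
  have Yv: "Y *\<^sub>v u = u - X *\<^sub>v u" if "u \<in> carrier_vec n" for u
    using that X by (simp add: Y_def minus_mult_distrib_mat_vec[of _ n n])
  have P: "Y ^\<^sub>m j \<in> carrier_mat n n" for j using Y by simp
  have comm: "X * Y = Y * X"
    using X by (simp add: Y_def mult_minus_distrib_mat[of _ n n _ n] minus_mult_distrib_mat[of _ n n])
  have XY: "X * Y = X - X * X" using X by (simp add: Y_def mult_minus_distrib_mat[of _ n n _ n])
  have psdY: "pos_semidef n Y"
    using le X by (auto simp: pos_semidef_def Yv scalar_prod_minus_distrib[of _ n])
  have "pos_semidef n (X * Y)"
    unfolding pos_semidef_def
  proof
    fix u :: "real vec" assume u: "u \<in> carrier_vec n"
    have "u \<bullet> (X * Y *\<^sub>v u) = u \<bullet> (X *\<^sub>v u) - (X *\<^sub>v u) \<bullet> (X *\<^sub>v u)"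
      using u X symmetric_scalar_prod[OF X u, of "X *\<^sub>v u"]
      by (simp add: XY minus_mult_distrib_mat_vec[of _ n n] scalar_prod_minus_distrib[of _ n]
          assoc_mult_mat_vec[of _ n n _ n])
    then show "0 \<le> u \<bullet> (X * Y *\<^sub>v u)" using pos_semidef_contraction[OF X psd le u] by simp
  qed
  then have psdXY: "pos_semidef n (X * Y ^\<^sub>m j)" for j
    by (intro pos_semidef_mult_pow) (use X Y comm psd in auto)
  have psdYj: "pos_semidef n (Y ^\<^sub>m j)" for j
  proof -
    have "pos_semidef n (1\<^sub>m n * Y ^\<^sub>m j)"
      by (rule pos_semidef_mult_pow) (use Y psdY in \<open>auto simp: pos_semidef_def scalar_prod_self_nonneg\<close>)
    then show ?thesis using left_mult_one_mat[OF P[of j]] by simp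
  qed
  \<comment> \<open>The two base cases hold because the forms of \<open>X^2\<close> and
    \<open>X^2 Y\<close> at \<open>u\<close> are those of \<open>1\<close> and \<open>Y\<close> at
    \<open>X u\<close>.\<close>
  have psdXXY: "pos_semidef n (X * X * Y ^\<^sub>m j)" for j
  proof (rule pos_semidef_mult_pow)
    show "X * X * Y = Y * (X * X)"
      using X Y comm assoc_mult_mat[OF X(1) X(1) Y(1)] assoc_mult_mat[OF X(1) Y(1) X(1)]
        assoc_mult_mat[OF Y(1) X(1) X(1)] by simp
    have "u \<bullet> (X * X *\<^sub>v u) = (X *\<^sub>v u) \<bullet> (X *\<^sub>v u)" if "u \<in> carrier_vec n" for u
      using that X symmetric_scalar_prod[OF X that, of "X *\<^sub>v u"]
      by (simp add: assoc_mult_mat_vec[of _ n n _ n])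
    then show "pos_semidef n (X * X)" by (simp add: pos_semidef_def scalar_prod_self_nonneg)
    have "X * X * Y = X * (Y * X)" using X Y comm assoc_mult_mat[OF X(1) X(1) Y(1)] by simp
    then have "u \<bullet> (X * X * Y *\<^sub>v u) = (X *\<^sub>v u) \<bullet> (Y *\<^sub>v (X *\<^sub>v u))" if "u \<in> carrier_vec n" for u
      using that X Y symmetric_scalar_prod[OF X that, of "Y *\<^sub>v (X *\<^sub>v u)"]
      by (simp add: assoc_mult_mat_vec[of _ n n _ n])
    then show "pos_semidef n (X * X * Y)" using psdY X by (simp add: pos_semidef_def)
  qed (use X Y in auto)
  define q where "q j = v \<bullet> (X * Y ^\<^sub>m j *\<^sub>v v)" for j
  show "0 \<le> v \<bullet> (X * Y ^\<^sub>m m *\<^sub>v v)" by (rule pos_semidefD[OF psdXY v])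
  have "X * Y ^\<^sub>m Suc j = X * Y ^\<^sub>m j - X * X * Y ^\<^sub>m j" for j
  proof -
    have "X * Y ^\<^sub>m Suc j = X * (Y * Y ^\<^sub>m j)" using commute_pow_mat[OF Y(1) Y(1) refl, of j] by simp
    also have "\<dots> = (X * Y) * Y ^\<^sub>m j" using assoc_mult_mat[OF X(1) Y(1) P[of j]] by simp
    also have "\<dots> = X * Y ^\<^sub>m j - X * X * Y ^\<^sub>m j"
      unfolding XY by (rule minus_mult_distrib_mat) (use X P in auto)
    finally show ?thesis .
  qed
  then have q_Suc: "q (Suc j) = q j - v \<bullet> (X * X * Y ^\<^sub>m j *\<^sub>v v)" for j
    unfolding q_def
    using scalar_prod_minus_mult_mat_vec[OF mult_carrier_mat[OF X(1) P]
        mult_carrier_mat[OF mult_carrier_mat[OF X(1) X(1)] P] v v, of j j] by simp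
  have "q (Suc j) \<le> q j" for j
    using q_Suc[of j] pos_semidefD[OF psdXXY[of j] v] by linarith
  then have "antimono q" by (simp add: antimono_iff_le_Suc)
  have YSuc: "Y ^\<^sub>m Suc j = Y ^\<^sub>m j - X * Y ^\<^sub>m j" for j
  proof -
    have "Y ^\<^sub>m Suc j = Y * Y ^\<^sub>m j" using commute_pow_mat[OF Y(1) Y(1) refl, of j] by simp
    also have "\<dots> = 1\<^sub>m n * Y ^\<^sub>m j - X * Y ^\<^sub>m j"
      using X P[of j] unfolding Y_def by (subst minus_mult_distrib_mat[of _ n n]) auto
    finally show ?thesis using left_mult_one_mat[OF P[of j]] by simp
  qed
  have "(\<Sum>j<i. q j) = v \<bullet> v - v \<bullet> (Y ^\<^sub>m i *\<^sub>v v)" for i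
  proof (induction i)
    case 0
    then show ?case using Y v by simp
  next
    case (Suc i)
    have "v \<bullet> (Y ^\<^sub>m Suc i *\<^sub>v v) = v \<bullet> (Y ^\<^sub>m i *\<^sub>v v) - q i"
      unfolding q_def YSuc
      by (rule scalar_prod_minus_mult_mat_vec) (use X P v in auto)
    then show ?case using Suc by simp
  qed
  from this[of "Suc m"] have "(\<Sum>j<Suc m. q j) \<le> v \<bullet> v"
    using pos_semidefD[OF psdYj[of "Suc m"] v] by linarith
  \<comment> \<open>The sum has the \<open>m + 1\<close> terms \<open>q 0, ..., q m\<close>, the
    last being the smallest; this is the origin of the factor \<open>Suc m\<close>.\<close>
  moreover have "(\<Sum>j<Suc m. q m) \<le> (\<Sum>j<Suc m. q j)"
    using \<open>antimono q\<close> by (intro sum_mono) (simp add: antimonoD)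
  ultimately show "real (Suc m) * (v \<bullet> (X * Y ^\<^sub>m m *\<^sub>v v)) \<le> v \<bullet> v" by (simp add: q_def)
qed

lemma transpose_pow_mat:
  fixes Y :: "'a :: comm_semiring_1 mat"
  assumes "Y \<in> carrier_mat n n" "transpose_mat Y = Y"
  shows "transpose_mat (Y ^\<^sub>m j) = Y ^\<^sub>m j"
proof (induction j)
  case 0
  then show ?case by simp
next
  case (Suc j)
  then show ?case
    using assms commute_pow_mat[OF assms(1) assms(1) refl, of j]
    by (simp add: transpose_mult[of "Y ^\<^sub>m j" n n Y n])
qed

lemma transpose_smult_mat: "transpose_mat (c \<cdot>\<^sub>m A) = c \<cdot>\<^sub>m transpose_mat A"
  by (rule eq_matI) auto

lemma smult_mat_mult_vec:
  assumes "A \<in> carrier_mat nr nc" "v \<in> carrier_vec nc"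
  shows "(c \<cdot>\<^sub>m A) *\<^sub>v v = c \<cdot>\<^sub>v (A *\<^sub>v v)"
  using assms by (intro eq_vecI) (auto simp: smult_scalar_prod_distrib[of _ nc])

text \<open>A form bound becomes a norm bound with the same constant: for
  \<open>B = (m + 1) X Y^m\<close> the forms give \<open>0 \<le> B \<le> 1\<close>, hence
  \<open>B^2 \<le> B \<le> 1\<close>, and the form of \<open>B^2\<close> at \<open>v\<close> is the
  squared norm of \<open>B v\<close>.\<close>

lemma smoothing_symmetric_contraction:
  fixes X :: "real mat"
  defines "Y \<equiv> 1\<^sub>m (dim_row X) - X"
  assumes X: "X \<in> carrier_mat n n" "transpose_mat X = X" and psd: "pos_semidef n X"
    and le: "\<And>v. v \<in> carrier_vec n \<Longrightarrow> v \<bullet> (X *\<^sub>v v) \<le> v \<bullet> v"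
    and v: "v \<in> carrier_vec n"
  shows "real (Suc m) * vec_norm2 (X * Y ^\<^sub>m m *\<^sub>v v) \<le> vec_norm2 v"
proof -
  define B where "B = real (Suc m) \<cdot>\<^sub>m (X * Y ^\<^sub>m m)"
  have Y: "Y \<in> carrier_mat n n" "transpose_mat Y = Y"
    using X by (auto simp: Y_def transpose_minus[of _ n n])
  have comm: "X * Y = Y * X"
    using X by (simp add: Y_def mult_minus_distrib_mat[of _ n n _ n] minus_mult_distrib_mat[of _ n n])
  have XY: "X * Y ^\<^sub>m m \<in> carrier_mat n n" "transpose_mat (X * Y ^\<^sub>m m) = X * Y ^\<^sub>m m"
    using X Y commute_pow_mat[OF X(1) Y(1) comm, of m] transpose_pow_mat[OF Y, of m]
    by (auto simp: transpose_mult[of _ n n _ n])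
  have B: "B \<in> carrier_mat n n" "transpose_mat B = B"
    using XY by (auto simp: B_def transpose_smult_mat)
  have Bu: "B *\<^sub>v u = real (Suc m) \<cdot>\<^sub>v (X * Y ^\<^sub>m m *\<^sub>v u)" if "u \<in> carrier_vec n" for u
    using XY that by (auto simp: B_def smult_mat_mult_vec[of _ n n])
  have q: "u \<bullet> (B *\<^sub>v u) = real (Suc m) * (u \<bullet> (X * Y ^\<^sub>m m *\<^sub>v u))" if "u \<in> carrier_vec n" for u
    using XY that by (simp add: Bu)
  note form = smoothing_quadratic_form[OF X psd le, folded Y_def, of _ m]
  have le': "u \<bullet> (B *\<^sub>v u) \<le> u \<bullet> u" if "u \<in> carrier_vec n" for u
    unfolding q[OF that] by (rule form(2)) (use that in auto)
  have "pos_semidef n B"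
    unfolding pos_semidef_def using form(1) q by simp
  from pos_semidef_contraction[OF B this le' v] le'[OF v]
  have "(B *\<^sub>v v) \<bullet> (B *\<^sub>v v) \<le> v \<bullet> v" by simp
  then have "vec_norm2 (B *\<^sub>v v) \<le> vec_norm2 v" by (simp add: vec_norm2_def)
  moreover have "vec_norm2 (B *\<^sub>v v) = real (Suc m) * vec_norm2 (X * Y ^\<^sub>m m *\<^sub>v v)"
    using XY v by (simp add: Bu vec_norm2_def real_sqrt_mult[symmetric] real_sqrt_mult
        flip: mult.assoc)
  ultimately show ?thesis by simp
qed

section \<open>The spectral norm and damped Jacobi iterations\<close>

text \<open>The constant is the Frobenius norm. Its purpose is to show that the supremum in
  \<open>spectral_norm\<close> is taken over a bounded set.\<close>

lemma vec_norm2_mult_le: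
  fixes A :: "real mat"
  assumes "A \<in> carrier_mat n m" "v \<in> carrier_vec m"
  shows "vec_norm2 (A *\<^sub>v v) \<le> sqrt (\<Sum>i<n. row A i \<bullet> row A i) * vec_norm2 v"
proof -
  have "(row A i \<bullet> v)\<^sup>2 \<le> (row A i \<bullet> row A i) * (v \<bullet> v)" if "i < n" for i
    by (rule cauchy_schwarz_vec) (use assms that in auto)
  then have "(\<Sum>i<n. (row A i \<bullet> v)\<^sup>2) \<le> (\<Sum>i<n. (row A i \<bullet> row A i) * (v \<bullet> v))"
    by (intro sum_mono) simp
  moreover have "(A *\<^sub>v v) \<bullet> (A *\<^sub>v v) = (\<Sum>i<n. (row A i \<bullet> v)\<^sup>2)"
    using assms by (simp add: scalar_prod_def[of _ "A *\<^sub>v v"] lessThan_atLeast0 power2_eq_square)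
  ultimately show ?thesis
    by (simp add: vec_norm2_def sum_distrib_right[symmetric] flip: real_sqrt_mult)
qed

lemma vec_norm2_pos: "v \<in> carrier_vec n \<Longrightarrow> v \<noteq> 0\<^sub>v n \<Longrightarrow> 0 < vec_norm2 v"
  by (simp add: vec_norm2_def scalar_prod_self_pos)

lemma vec_norm2_smult: "vec_norm2 (c \<cdot>\<^sub>v v) = \<bar>c\<bar> * vec_norm2 v"
proof -
  have "(c \<cdot>\<^sub>v v) \<bullet> (c \<cdot>\<^sub>v v) = c\<^sup>2 * (v \<bullet> v)"
    by (simp add: scalar_prod_def sum_distrib_left power2_eq_square ac_simps)
  then show ?thesis by (simp add: vec_norm2_def real_sqrt_mult)
qed

text \<open>The condition \<open>0 < m\<close> keeps the set of nonzero vectors nonempty, as a real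
  supremum over the empty set carries no information.\<close>

lemma spectral_norm_leI:
  assumes A: "A \<in> carrier_mat n m" and m: "0 < m"
    and le: "\<And>v. v \<in> carrier_vec m \<Longrightarrow> vec_norm2 (A *\<^sub>v v) \<le> c * vec_norm2 v"
  shows "spectral_norm A \<le> c"
  unfolding spectral_norm_def
proof (rule cSUP_least)
  have "unit_vec m 0 \<noteq> (0\<^sub>v m :: real vec)"
    using m by (auto simp: vec_eq_iff)
  then show "{v \<in> carrier_vec (dim_col A). v \<noteq> (0\<^sub>v (dim_col A) :: real vec)} \<noteq> {}"
    using A by (auto intro!: exI[of _ "unit_vec m 0"])
  show "vec_norm2 (A *\<^sub>v v) / vec_norm2 v \<le> c"
    if "v \<in> {v \<in> carrier_vec (dim_col A). v \<noteq> 0\<^sub>v (dim_col A)}" for v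
    using that A le[of v] vec_norm2_pos[of v m] by (simp add: divide_le_eq)
qed

lemma vec_norm2_le_spectral_norm:
  assumes A: "A \<in> carrier_mat n m" and v: "v \<in> carrier_vec m" "v \<noteq> 0\<^sub>v m"
  shows "vec_norm2 (A *\<^sub>v v) / vec_norm2 v \<le> spectral_norm A"
  unfolding spectral_norm_def
proof (rule cSUP_upper)
  let ?c = "sqrt (\<Sum>i<n. row A i \<bullet> row A i)"
  show "bdd_above ((\<lambda>v. vec_norm2 (A *\<^sub>v v) / vec_norm2 v) `
      {v \<in> carrier_vec (dim_col A). v \<noteq> 0\<^sub>v (dim_col A)})"
    using A vec_norm2_mult_le[OF A] vec_norm2_pos
    by (intro bdd_aboveI[of _ ?c]) (auto simp: divide_le_eq)
qed (use A v in auto)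

text \<open>The \<open>j\<close>-th unit vector is mapped to the \<open>j\<close>-th column, whose
  norm dominates each entry. Applied to a diagonal entry, this bounds the norm of a block from below
  by \<open>a\<close>.\<close>

lemma entry_le_spectral_norm:
  assumes A: "A \<in> carrier_mat n m" and ij: "i < n" "j < m"
  shows "A $$ (i, j) \<le> spectral_norm A"
proof -
  let ?e = "unit_vec m j :: real vec"
  have e: "?e \<in> carrier_vec m" "?e \<noteq> 0\<^sub>v m" "vec_norm2 ?e = 1"
    using ij by (auto simp: vec_eq_iff vec_norm2_def)
  have Ae: "A *\<^sub>v ?e = col A j" using A ij by (intro eq_vecI) auto
  have "(A $$ (i, j))\<^sup>2 \<le> (\<Sum>k\<in>{0..<n}. (A $$ (k, j))\<^sup>2)"
    using ij by (intro member_le_sum) auto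
  also have "\<dots> = col A j \<bullet> col A j"
    using A ij by (simp add: scalar_prod_def power2_eq_square)
  finally have "A $$ (i, j) \<le> vec_norm2 (col A j)"
    unfolding vec_norm2_def by (rule real_le_rsqrt)
  then show ?thesis using vec_norm2_le_spectral_norm[OF A e(1,2)] e(3) by (simp add: Ae)
qed

text \<open>With \<open>T = V X U\<close>, \<open>A = (1/\<omega>) U X U\<close> and
  \<open>(1 - T)^m = V Y^m U\<close>, the inner \<open>U V\<close> cancels and
  \<open>A (1 - T)^m = (1/\<omega>) U (X Y^m) U\<close> remains. Each outer factor \<open>U\<close>
  costs \<open>1 / sqrt w0\<close>; the power bound \<open>c\<close> does not reach the
  conclusion.\<close>

lemma weighted_jacobi_smoothing:
  fixes A :: "real mat" and w :: "nat \<Rightarrow> real" and \<omega> :: real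
  defines "T \<equiv> \<omega> \<cdot>\<^sub>m (mat_diag (dim_row A) w * A)"
  assumes A: "A \<in> carrier_mat n n" "transpose_mat A = A" and psd: "pos_semidef n A"
    and w: "0 < w0" "\<And>i. i < n \<Longrightarrow> w0 \<le> w i" and \<omega>: "0 < \<omega>"
    and bounded: "\<And>k. norm_bound (T ^\<^sub>m k) c"
    and v: "v \<in> carrier_vec n"
  shows "vec_norm2 (A * (1\<^sub>m n - T) ^\<^sub>m m *\<^sub>v v) \<le> 1 / (w0 * \<omega> * real (Suc m)) * vec_norm2 v"
proof -
  define V where "V = mat_diag n (\<lambda>i. sqrt (w i))"
  define U where "U = mat_diag n (\<lambda>i. 1 / sqrt (w i))"
  define X where "X = \<omega> \<cdot>\<^sub>m (V * A * V)"
  define Y where "Y = 1\<^sub>m n - X"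
  have wpos: "0 < w i" if "i < n" for i using w that by force
  have V: "V \<in> carrier_mat n n" "transpose_mat V = V"
    by (auto simp: V_def mat_diag_def intro!: eq_matI)
  have U: "U \<in> carrier_mat n n" by (simp add: U_def)
  have UV: "U * V = 1\<^sub>m n" and VU: "V * U = 1\<^sub>m n"
    unfolding U_def V_def mat_diag_diag using wpos[THEN less_imp_neq]
    by (intro eq_matI; auto simp: mat_diag_def)+
  have X: "X \<in> carrier_mat n n" using A V by (simp add: X_def)
  have X_entries: "X = mat n n (\<lambda>(i, j). \<omega> * (sqrt (w i) * A $$ (i, j) * sqrt (w j)))"
    using A V by (auto simp: X_def V_def mat_diag_mult_left[OF A(1)] mat_diag_mult_right[of _ n n]
        intro!: eq_matI)
  have Xsym: "transpose_mat X = X"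
  proof (rule eq_matI)
    fix i j assume "i < dim_row X" "j < dim_col X"
    then show "transpose_mat X $$ (i, j) = X $$ (i, j)"
      using A X index_transpose_mat(1)[of i A j] by (simp add: X_entries)
  qed (use X in auto)
  have T: "T \<in> carrier_mat n n"
    using mult_carrier_mat[OF mat_diag_dim A(1), of w] A by (simp add: T_def)
  \<comment> \<open>The diagonal matrix of the weights is \<open>V^2\<close>, so
    \<open>T = \<omega> V^2 A = V (\<omega> V A V) U\<close>.\<close>
  have T_eq: "T = V * X * U"
  proof (rule eq_matI)
    fix i j assume "i < dim_row (V * X * U)" "j < dim_col (V * X * U)"
    then have ij: "i < n" "j < n" using V U by auto
    have "sqrt (w i) * sqrt (w i) = w i" "sqrt (w j) \<noteq> 0" using wpos[of i] wpos[of j] ij by auto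
    then show "T $$ (i, j) = (V * X * U) $$ (i, j)"
      using ij A by (simp add: T_def X_entries V_def U_def mat_diag_mult_left[of _ n n]
          mat_diag_mult_right[of _ n n] field_simps)
  qed (use V U T in auto)
  have A_eq: "A = (1 / \<omega>) \<cdot>\<^sub>m (U * X * U)"
  proof (rule eq_matI)
    fix i j assume "i < dim_row ((1 / \<omega>) \<cdot>\<^sub>m (U * X * U))" "j < dim_col ((1 / \<omega>) \<cdot>\<^sub>m (U * X * U))"
    then have ij: "i < n" "j < n" using U by auto
    have "sqrt (w i) \<noteq> 0" "sqrt (w j) \<noteq> 0" using wpos[of i] wpos[of j] ij by auto
    then show "A $$ (i, j) = ((1 / \<omega>) \<cdot>\<^sub>m (U * X * U)) $$ (i, j)"
      using ij A \<omega> by (simp add: X_entries U_def mat_diag_mult_left[of _ n n]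
          mat_diag_mult_right[of _ n n] field_simps)
  qed (use U A in auto)
  have sim: "similar_mat_wit T X V U"
    by (rule similar_mat_witI[OF VU UV T_eq T X V(1) U])
  have Xpow: "X ^\<^sub>m k = U * T ^\<^sub>m k * V" for k
    by (rule similar_mat_wit_pow_id[OF similar_mat_wit_sym[OF sim]])
  obtain bU bV where b: "norm_bound U bU" "norm_bound V bV" using norm_bound_max by blast
  \<comment> \<open>An entrywise bound picks up the dimension \<open>n\<close> with each matrix
    product. All that counts is that the result is independent of \<open>k\<close>.\<close>
  have Xbound: "norm_bound (X ^\<^sub>m k) (bU * c * real n * bV * real n)" for k
    unfolding Xpow
    using norm_bound_mult[OF mult_carrier_mat[OF U pow_carrier_mat[OF T, of k]] V(1)
        norm_bound_mult[OF U pow_carrier_mat[OF T, of k] b(1) bounded[of k]] b(2)]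
    by simp
  have Xpsd: "pos_semidef n X"
    unfolding pos_semidef_def
  proof
    fix u :: "real vec" assume u: "u \<in> carrier_vec n"
    have Vu: "V *\<^sub>v u \<in> carrier_vec n" using V u by auto
    have "X *\<^sub>v u = \<omega> \<cdot>\<^sub>v (V *\<^sub>v (A *\<^sub>v (V *\<^sub>v u)))"
      unfolding X_def using A V u Vu
      by (simp add: smult_mat_mult_vec[of _ n n] assoc_mult_mat_vec[of _ n n _ n])
    then have "u \<bullet> (X *\<^sub>v u) = \<omega> * ((V *\<^sub>v u) \<bullet> (A *\<^sub>v (V *\<^sub>v u)))"
      using symmetric_scalar_prod[OF V u, of "A *\<^sub>v (V *\<^sub>v u)"] A V u Vu by simp
    then show "0 \<le> u \<bullet> (X *\<^sub>v u)" using pos_semidefD[OF psd Vu] \<omega> by simp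
  qed
  have Xle: "u \<bullet> (X *\<^sub>v u) \<le> u \<bullet> u" if "u \<in> carrier_vec n" for u
    by (rule scalar_prod_mult_le_self[OF X that])
      (rule symmetric_power_bounded_contraction[OF X Xsym Xbound that])
  have U_norm: "vec_norm2 (U *\<^sub>v u) \<le> 1 / sqrt w0 * vec_norm2 u" if u: "u \<in> carrier_vec n" for u
  proof -
    have Uu: "(U *\<^sub>v u) $ i = u $ i / sqrt (w i)" if "i < n" for i
    proof -
      have "row U i \<bullet> u = (\<Sum>j\<in>{0..<n}. if j = i then u $ i / sqrt (w i) else 0)"
        unfolding scalar_prod_def using u that by (intro sum.cong) (auto simp: U_def mat_diag_def)
      then show ?thesis using that U by simp
    qed
    have "(U *\<^sub>v u) \<bullet> (U *\<^sub>v u) = (\<Sum>i\<in>{0..<n}. (U *\<^sub>v u) $ i * (U *\<^sub>v u) $ i)"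
      using U by (simp add: scalar_prod_def[of "U *\<^sub>v u" "U *\<^sub>v u"] del: index_mult_mat_vec)
    also have "\<dots> \<le> (\<Sum>i\<in>{0..<n}. (1 / w0) * (u $ i * u $ i))"
    proof (rule sum_mono)
      fix i assume "i \<in> {0..<n}"
      then have i: "i < n" by simp
      have "(U *\<^sub>v u) $ i * (U *\<^sub>v u) $ i = (u $ i * u $ i) / w i"
        using wpos[OF i] by (simp add: Uu[OF i])
      also have "\<dots> \<le> (u $ i * u $ i) / w0"
        by (rule divide_left_mono) (use w wpos[OF i] i in auto)
      finally show "(U *\<^sub>v u) $ i * (U *\<^sub>v u) $ i \<le> (1 / w0) * (u $ i * u $ i)" by simp
    qed
    also have "\<dots> = (1 / w0) * (u \<bullet> u)" using u by (simp add: scalar_prod_def sum_distrib_left)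
    finally have "sqrt ((U *\<^sub>v u) \<bullet> (U *\<^sub>v u)) \<le> sqrt ((1 / w0) * (u \<bullet> u))" by simp
    then show ?thesis unfolding vec_norm2_def real_sqrt_mult by (simp add: real_sqrt_divide)
  qed
  have Y: "Y \<in> carrier_mat n n" and Ym: "Y ^\<^sub>m m \<in> carrier_mat n n" using X by (auto simp: Y_def)
  have "1\<^sub>m n - T = V * Y * U"
    using V U X VU by (simp add: Y_def T_eq mult_minus_distrib_mat[of _ n n _ n]
        minus_mult_distrib_mat[of _ n n])
  from similar_mat_witI[OF VU UV this _ Y V(1) U]
  have "similar_mat_wit (1\<^sub>m n - T) Y V U" using minus_carrier_mat[OF T] by blast
  then have pow: "(1\<^sub>m n - T) ^\<^sub>m m = V * Y ^\<^sub>m m * U" by (rule similar_mat_wit_pow_id)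
  have "A *\<^sub>v ((1\<^sub>m n - T) ^\<^sub>m m *\<^sub>v v) = (1 / \<omega>) \<cdot>\<^sub>v (U *\<^sub>v (X * Y ^\<^sub>m m *\<^sub>v (U *\<^sub>v v)))"
  proof -
    define y where "y = Y ^\<^sub>m m *\<^sub>v (U *\<^sub>v v)"
    have y: "y \<in> carrier_vec n" "V *\<^sub>v y \<in> carrier_vec n" using Ym U V v by (auto simp: y_def)
    have "(1\<^sub>m n - T) ^\<^sub>m m *\<^sub>v v = V *\<^sub>v y"
      unfolding pow y_def using V U Ym v by (simp add: assoc_mult_mat_vec[of _ n n _ n])
    moreover have "A *\<^sub>v (V *\<^sub>v y) = (1 / \<omega>) \<cdot>\<^sub>v (U *\<^sub>v (X *\<^sub>v (U *\<^sub>v (V *\<^sub>v y))))"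
      by (subst A_eq) (use U X y in \<open>simp add: smult_mat_mult_vec[of _ n n] assoc_mult_mat_vec[of _ n n _ n]\<close>)
    moreover have "U *\<^sub>v (V *\<^sub>v y) = y"
      using U V y UV by (simp flip: assoc_mult_mat_vec[of _ n n _ n])
    moreover have "X *\<^sub>v y = X * Y ^\<^sub>m m *\<^sub>v (U *\<^sub>v v)"
      unfolding y_def by (rule assoc_mult_mat_vec[symmetric, OF X Ym]) (use U v in auto)
    ultimately show ?thesis by simp
  qed
  moreover have "A * (1\<^sub>m n - T) ^\<^sub>m m *\<^sub>v v = A *\<^sub>v ((1\<^sub>m n - T) ^\<^sub>m m *\<^sub>v v)"
    by (rule assoc_mult_mat_vec[OF A(1) pow_carrier_mat[OF minus_carrier_mat[OF T]] v])
  ultimately have eq: "vec_norm2 (A * (1\<^sub>m n - T) ^\<^sub>m m *\<^sub>v v) =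
      1 / \<omega> * vec_norm2 (U *\<^sub>v (X * Y ^\<^sub>m m *\<^sub>v (U *\<^sub>v v)))"
    using \<omega> by (simp add: vec_norm2_smult)
  have Uv: "U *\<^sub>v v \<in> carrier_vec n" using U v by auto
  have XYUv: "X * Y ^\<^sub>m m *\<^sub>v (U *\<^sub>v v) \<in> carrier_vec n"
    by (rule mult_mat_vec_carrier[OF mult_carrier_mat[OF X Ym] Uv])
  have dimX: "dim_row X = n" using X by simp
  have "vec_norm2 (U *\<^sub>v (X * Y ^\<^sub>m m *\<^sub>v (U *\<^sub>v v))) \<le> 1 / sqrt w0 * vec_norm2 (X * Y ^\<^sub>m m *\<^sub>v (U *\<^sub>v v))"
    by (rule U_norm[OF XYUv])
  moreover have "vec_norm2 (X * Y ^\<^sub>m m *\<^sub>v (U *\<^sub>v v)) \<le> 1 / real (Suc m) * vec_norm2 (U *\<^sub>v v)"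
    using smoothing_symmetric_contraction[OF X Xsym Xpsd Xle Uv, unfolded dimX, folded Y_def, of m]
    by (simp add: field_simps)
  moreover have "vec_norm2 (U *\<^sub>v v) \<le> 1 / sqrt w0 * vec_norm2 v" by (rule U_norm[OF v])
  ultimately have "vec_norm2 (U *\<^sub>v (X * Y ^\<^sub>m m *\<^sub>v (U *\<^sub>v v))) \<le>
      1 / sqrt w0 * (1 / real (Suc m) * (1 / sqrt w0 * vec_norm2 v))"
    using w by (meson mult_left_mono order_trans less_imp_le zero_le_divide_1_iff of_nat_0_le_iff
        real_sqrt_ge_zero)
  also have "\<dots> = 1 / (w0 * real (Suc m)) * vec_norm2 v"
    using w by (simp add: field_simps)
  finally have "1 / \<omega> * vec_norm2 (U *\<^sub>v (X * Y ^\<^sub>m m *\<^sub>v (U *\<^sub>v v))) \<le>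
      1 / \<omega> * (1 / (w0 * real (Suc m)) * vec_norm2 v)"
    using \<omega> by (intro mult_left_mono) auto
  then show ?thesis unfolding eq by (simp add: field_simps)
qed

section \<open>Block diagonal matrices and Kronecker products\<close>

text \<open>The extraction of \<open>param_block\<close>, but addressed by position instead of
  multi-index, because the recursion over Kronecker factors computes with positions.\<close>

definition diag_block :: "nat \<Rightarrow> nat \<Rightarrow> 'a mat \<Rightarrow> 'a mat" where
  "diag_block n0 j M = mat n0 n0 (\<lambda>(r, c). M $$ (j * n0 + r, j * n0 + c))"

definition block_diagonal :: "nat \<Rightarrow> 'a :: zero mat \<Rightarrow> bool" where
  "block_diagonal n0 M \<longleftrightarrow>
     (\<forall>r < dim_row M. \<forall>c < dim_col M. r div n0 \<noteq> c div n0 \<longrightarrow> M $$ (r, c) = 0)"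

lemma param_block_eq_diag_block: "param_block d n n0 M i = diag_block n0 (block_number d n i) M"
  by (simp add: param_block_def diag_block_def)

lemma diag_block_carrier [simp]: "diag_block n0 j M \<in> carrier_mat n0 n0"
  by (simp add: diag_block_def)

lemma block_index_less: "j < K \<Longrightarrow> r < n0 \<Longrightarrow> j * n0 + r < K * (n0 :: nat)"
  using mult_le_mono1[of "Suc j" K n0] by simp

text \<open>Block diagonality of the left factor already confines the inner summation index to block
  \<open>j\<close>, so the right factor may be arbitrary. Powers are therefore treated by splitting
  off a factor on the left.\<close>

lemma diag_block_mult:
  fixes M N :: "'a :: comm_semiring_0 mat"
  assumes M: "M \<in> carrier_mat (K * n0) (K * n0)" "block_diagonal n0 M"
    and N: "N \<in> carrier_mat (K * n0) (K * n0)" and j: "j < K"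
  shows "diag_block n0 j (M * N) = diag_block n0 j M * diag_block n0 j N"
proof (rule eq_matI)
  fix r c assume "r < dim_row (diag_block n0 j M * diag_block n0 j N)"
    "c < dim_col (diag_block n0 j M * diag_block n0 j N)"
  then have rc: "r < n0" "c < n0" by (auto simp: diag_block_def)
  note idx = block_index_less[OF j rc(1)] block_index_less[OF j rc(2)]
  let ?f = "\<lambda>s. M $$ (j * n0 + r, s) * N $$ (s, j * n0 + c)"
  have zero: "?f s = 0" if "s \<in> {0..<K * n0} - (\<lambda>t. j * n0 + t) ` {0..<n0}" for s
  proof -
    have "s div n0 \<noteq> j"
    proof
      assume "s div n0 = j"
      then have "s = j * n0 + s mod n0" by (metis div_mult_mod_eq)
      moreover have "s mod n0 \<in> {0..<n0}" using rc by simp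
      ultimately have "s \<in> (\<lambda>t. j * n0 + t) ` {0..<n0}" by (rule image_eqI)
      then show False using that by simp
    qed
    then have "M $$ (j * n0 + r, s) = 0"
      using that M idx rc by (simp add: block_diagonal_def)
    then show ?thesis by simp
  qed
  have "diag_block n0 j (M * N) $$ (r, c) = (\<Sum>s\<in>{0..<K * n0}. ?f s)"
    using rc idx M N by (simp add: diag_block_def scalar_prod_def)
  also have "\<dots> = sum ?f ((\<lambda>t. j * n0 + t) ` {0..<n0})"
  proof (rule sum.mono_neutral_right)
    show "(\<lambda>t. j * n0 + t) ` {0..<n0} \<subseteq> {0..<K * n0}"
    proof
      fix s assume "s \<in> (\<lambda>t. j * n0 + t) ` {0..<n0}"
      then obtain t where "t < n0" "s = j * n0 + t" unfolding image_iff by auto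
      then show "s \<in> {0..<K * n0}" using block_index_less[OF j, of t n0] by simp
    qed
  qed (use zero in auto)
  also have "\<dots> = (\<Sum>t\<in>{0..<n0}. ?f (j * n0 + t))"
    by (subst sum.reindex) (auto simp: inj_on_def)
  also have "\<dots> = (diag_block n0 j M * diag_block n0 j N) $$ (r, c)"
    using rc by (simp add: diag_block_def scalar_prod_def)
  finally show "diag_block n0 j (M * N) $$ (r, c) = (diag_block n0 j M * diag_block n0 j N) $$ (r, c)" .
qed (auto simp: diag_block_def)

lemma diag_block_one: "j < K \<Longrightarrow> diag_block n0 j (1\<^sub>m (K * n0)) = 1\<^sub>m n0"
  by (rule eq_matI) (auto simp: diag_block_def block_index_less)

lemma diag_block_pow:
  fixes M :: "'a :: comm_semiring_1 mat"
  assumes M: "M \<in> carrier_mat (K * n0) (K * n0)" "block_diagonal n0 M" and j: "j < K"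
  shows "diag_block n0 j (M ^\<^sub>m k) = diag_block n0 j M ^\<^sub>m k"
proof (induction k)
  case 0
  then show ?case using M j diag_block_one[OF j, of n0] by (simp add: diag_block_def)
next
  case (Suc k)
  have "diag_block n0 j (M ^\<^sub>m Suc k) = diag_block n0 j (M * M ^\<^sub>m k)"
    using commute_pow_mat[OF M(1) M(1) refl, of k] by simp
  also have "\<dots> = diag_block n0 j M * diag_block n0 j (M ^\<^sub>m k)"
    by (rule diag_block_mult[OF M _ j]) (use M in simp)
  also have "\<dots> = diag_block n0 j M ^\<^sub>m Suc k"
    using commute_pow_mat[OF diag_block_carrier diag_block_carrier refl, of n0 j M k] Suc by simp
  finally show ?case .
qed

lemma diag_block_mat_diag_mult:
  fixes M :: "'a :: comm_semiring_1 mat"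
  assumes M: "M \<in> carrier_mat (K * n0) (K * n0)" and j: "j < K"
  shows "diag_block n0 j (mat_diag (K * n0) f * M) =
    mat_diag n0 (\<lambda>r. f (j * n0 + r)) * diag_block n0 j M"
proof (rule eq_matI)
  fix r c assume "r < dim_row (mat_diag n0 (\<lambda>r. f (j * n0 + r)) * diag_block n0 j M)"
    "c < dim_col (mat_diag n0 (\<lambda>r. f (j * n0 + r)) * diag_block n0 j M)"
  then have rc: "r < n0" "c < n0" by (auto simp: diag_block_def mat_diag_def)
  then show "diag_block n0 j (mat_diag (K * n0) f * M) $$ (r, c) =
      (mat_diag n0 (\<lambda>r. f (j * n0 + r)) * diag_block n0 j M) $$ (r, c)"
    using block_index_less[OF j]
    unfolding mat_diag_mult_left[OF M] mat_diag_mult_left[OF diag_block_carrier[of n0 j M]]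
    by (simp add: diag_block_def)
qed (auto simp: diag_block_def mat_diag_def)

lemma block_diagonal_mat_diag_mult:
  fixes M :: "'a :: comm_semiring_1 mat"
  assumes "M \<in> carrier_mat N N" "block_diagonal n0 M"
  shows "block_diagonal n0 (mat_diag N f * M)"
  using assms by (auto simp: block_diagonal_def mat_diag_mult_left[of _ N N])

lemma diag_block_smult:
  assumes M: "M \<in> carrier_mat (K * n0) (K * n0)" and j: "j < K"
  shows "diag_block n0 j (a \<cdot>\<^sub>m M) = a \<cdot>\<^sub>m diag_block n0 j M"
  using M block_index_less[OF j] by (intro eq_matI) (auto simp: diag_block_def)

lemma diag_block_minus:
  fixes M N :: "'a :: ring mat"
  assumes "M \<in> carrier_mat (K * n0) (K * n0)" "N \<in> carrier_mat (K * n0) (K * n0)" and j: "j < K"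
  shows "diag_block n0 j (M - N) = diag_block n0 j M - diag_block n0 j N"
  using assms block_index_less[OF j] by (intro eq_matI) (auto simp: diag_block_def)

section \<open>Mixed-radix block positions and Kronecker chains\<close>

text \<open>The last parameter is the most significant digit, just as its factor is the outermost
  one in \<open>kronecker_chain\<close>; inductions over \<open>d\<close> peel off both
  together.\<close>

lemma block_number_Suc:
  "block_number (Suc d) n i = i (Suc d) * (\<Prod>\<mu>=1..d. n \<mu>) + block_number d n i"
  by (simp add: block_number_def atLeastLessThanSuc_atLeastAtMost)

lemma block_number_less:
  assumes "\<And>\<mu>. \<mu> \<in> {1..d} \<Longrightarrow> i \<mu> < n \<mu>"
  shows "block_number d n i < (\<Prod>\<mu>=1..d. n \<mu>)"
  using assms
proof (induction d)
  case (Suc d)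
  then have "block_number d n i < (\<Prod>\<mu>=1..d. n \<mu>)" "i (Suc d) < n (Suc d)" by auto
  then show ?case using block_index_less[of "i (Suc d)" "n (Suc d)" "block_number d n i" "\<Prod>\<mu>=1..d. n \<mu>"]
    by (simp add: block_number_Suc mult.commute)
qed (simp add: block_number_def)

lemma kronecker_carrier:
  assumes "A \<in> carrier_mat m m" "B \<in> carrier_mat n n"
  shows "kronecker A B \<in> carrier_mat (m * n) (m * n)"
  using assms by (simp add: kronecker_def)

lemma kronecker_chain_carrier:
  assumes "\<And>\<mu>. \<mu> \<in> {1..d} \<Longrightarrow> F \<mu> \<in> carrier_mat (n \<mu>) (n \<mu>)" "M \<in> carrier_mat n0 n0"
  shows "kronecker_chain F d M \<in> carrier_mat ((\<Prod>\<mu>=1..d. n \<mu>) * n0) ((\<Prod>\<mu>=1..d. n \<mu>) * n0)"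
  using assms
proof (induction d)
  case (Suc d)
  then have "kronecker_chain F (Suc d) M \<in>
      carrier_mat (n (Suc d) * ((\<Prod>\<mu>=1..d. n \<mu>) * n0)) (n (Suc d) * ((\<Prod>\<mu>=1..d. n \<mu>) * n0))"
    unfolding kronecker_chain.simps by (intro kronecker_carrier) auto
  then show ?case by (simp add: ac_simps)
qed simp

text \<open>Either the two indices lie in different copies of \<open>B\<close>, where the entry of
  \<open>A\<close> vanishes, or they lie in the same copy, where their block positions inside
  \<open>B\<close> must differ.\<close>

lemma block_diagonal_kronecker:
  assumes A: "A \<in> carrier_mat m m" "\<And>r c. r < m \<Longrightarrow> c < m \<Longrightarrow> r \<noteq> c \<Longrightarrow> A $$ (r, c) = 0"
    and B: "B \<in> carrier_mat (K * n0) (K * n0)" "block_diagonal n0 B"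
  shows "block_diagonal n0 (kronecker A B)"
  unfolding block_diagonal_def
proof (intro allI impI)
  fix r c assume r: "r < dim_row (kronecker A B)" and c: "c < dim_col (kronecker A B)"
    and ne: "r div n0 \<noteq> c div n0"
  let ?N = "K * n0"
  have r: "r < m * ?N" and c: "c < m * ?N" using r c A B by (auto simp: kronecker_def)
  then have N: "0 < ?N" by (cases "?N = 0") auto
  have lt: "r div ?N < m" "c div ?N < m" using r c by (auto simp: less_mult_imp_div_less)
  have modlt: "r mod ?N < ?N" "c mod ?N < ?N" using N by auto
  have entry: "kronecker A B $$ (r, c) = A $$ (r div ?N, c div ?N) * B $$ (r mod ?N, c mod ?N)"
    using r c A B by (simp add: kronecker_def)
  show "kronecker A B $$ (r, c) = 0"
  proof (cases "r div ?N = c div ?N")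
    case True
    have split: "s div n0 = (s div ?N) * K + (s mod ?N) div n0" for s
    proof -
      have "s div n0 = ((s div ?N * K) * n0 + s mod ?N) div n0"
        by (metis div_mult_mod_eq mult.assoc)
      then show ?thesis using N by simp
    qed
    have "(r mod ?N) div n0 \<noteq> (c mod ?N) div n0" using ne True split[of r] split[of c] by metis
    then have "B $$ (r mod ?N, c mod ?N) = 0" using B modlt by (auto simp: block_diagonal_def)
    then show ?thesis using entry by simp
  next
    case False
    then show ?thesis using A(2)[OF lt] entry by simp
  qed
qed

lemma block_diagonal_kronecker_chain:
  assumes "\<And>\<mu>. \<mu> \<in> {1..d} \<Longrightarrow> F \<mu> \<in> carrier_mat (n \<mu>) (n \<mu>)" "M \<in> carrier_mat n0 n0"
    and "\<And>\<mu> r c. \<mu> \<in> {1..d} \<Longrightarrow> r < n \<mu> \<Longrightarrow> c < n \<mu> \<Longrightarrow> r \<noteq> c \<Longrightarrow> F \<mu> $$ (r, c) = 0"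
  shows "block_diagonal n0 (kronecker_chain F d M)"
  using assms
proof (induction d)
  case 0
  then show ?case by (auto simp: block_diagonal_def)
next
  case (Suc d)
  show ?case
    unfolding kronecker_chain.simps
    by (rule block_diagonal_kronecker[OF _ _ kronecker_chain_carrier[of d F n M n0]])
      (use Suc in auto)
qed

lemma diag_block_kronecker:
  assumes A: "A \<in> carrier_mat m m" and B: "B \<in> carrier_mat (K * n0) (K * n0)"
    and ij: "i < m" "j < K"
  shows "diag_block n0 (i * K + j) (kronecker A B) = A $$ (i, i) \<cdot>\<^sub>m diag_block n0 j B"
proof (rule eq_matI)
  fix r c assume "r < dim_row (A $$ (i, i) \<cdot>\<^sub>m diag_block n0 j B)"
    "c < dim_col (A $$ (i, i) \<cdot>\<^sub>m diag_block n0 j B)"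
  then have rc: "r < n0" "c < n0" by (auto simp: diag_block_def)
  have *: "(i * K + j) * n0 + s = i * (K * n0) + (j * n0 + s)" for s by (simp add: algebra_simps)
  have lt: "j * n0 + s < K * n0" if "s < n0" for s using block_index_less[OF ij(2) that] .
  have lt': "i * (K * n0) + (j * n0 + s) < m * (K * n0)" if "s < n0" for s
    by (rule block_index_less[OF ij(1) lt[OF that]])
  have div_mod: "(i * (K * n0) + (j * n0 + s)) div (K * n0) = i"
    "(i * (K * n0) + (j * n0 + s)) mod (K * n0) = j * n0 + s" if "s < n0" for s
  proof -
    have "K * n0 \<noteq> 0" using lt[OF that] by linarith
    then show "(i * (K * n0) + (j * n0 + s)) div (K * n0) = i"
      using div_mult_self3[of "K * n0" i "j * n0 + s"] div_less[OF lt[OF that]] by linarith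
    show "(i * (K * n0) + (j * n0 + s)) mod (K * n0) = j * n0 + s"
      by (simp only: mod_mult_self3 mod_less[OF lt[OF that]])
  qed
  show "diag_block n0 (i * K + j) (kronecker A B) $$ (r, c) = (A $$ (i, i) \<cdot>\<^sub>m diag_block n0 j B) $$ (r, c)"
    using rc lt[OF rc(1)] lt[OF rc(2)] lt'[OF rc(1)] lt'[OF rc(2)] A B
    unfolding diag_block_def *
    by (simp add: kronecker_def div_mod[OF rc(1)] div_mod[OF rc(2)])
qed (auto simp: diag_block_def)

lemma diag_block_kronecker_chain:
  assumes "\<And>\<mu>. \<mu> \<in> {1..d} \<Longrightarrow> F \<mu> \<in> carrier_mat (n \<mu>) (n \<mu>)" "M \<in> carrier_mat n0 n0"
    and "\<And>\<mu>. \<mu> \<in> {1..d} \<Longrightarrow> i \<mu> < n \<mu>"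
  shows "diag_block n0 (block_number d n i) (kronecker_chain F d M) =
    (\<Prod>\<mu>=1..d. F \<mu> $$ (i \<mu>, i \<mu>)) \<cdot>\<^sub>m M"
  using assms
proof (induction d)
  case 0
  then show ?case by (intro eq_matI) (auto simp: diag_block_def block_number_def)
next
  case (Suc d)
  have "diag_block n0 (block_number (Suc d) n i) (kronecker_chain F (Suc d) M) =
      F (Suc d) $$ (i (Suc d), i (Suc d)) \<cdot>\<^sub>m diag_block n0 (block_number d n i) (kronecker_chain F d M)"
    unfolding block_number_Suc kronecker_chain.simps
    by (rule diag_block_kronecker[OF _ kronecker_chain_carrier[of d F n M n0]])
      (use Suc block_number_less[of d i n] in auto)
  also have "\<dots> = (\<Prod>\<mu>=1..Suc d. F \<mu> $$ (i \<mu>, i \<mu>)) \<cdot>\<^sub>m M"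
    using Suc by (auto intro!: eq_matI)
  finally show ?case .
qed

section \<open>Block structure of the affine operator\<close>

lemma affine_operator_carrier:
  assumes "\<And>\<nu>. \<nu> \<le> d \<Longrightarrow> A \<nu> \<in> carrier_mat n0 n0"
  shows "affine_operator d n p n0 A \<in> carrier_mat ((\<Prod>\<mu>=1..d. n \<mu>) * n0) ((\<Prod>\<mu>=1..d. n \<mu>) * n0)"
  by (simp add: affine_operator_def mat_sum_def)

lemma affine_operator_chain_carrier:
  fixes d n0 :: nat and n :: "nat \<Rightarrow> nat" and p :: "nat \<Rightarrow> nat \<Rightarrow> real"
  defines "N \<equiv> (\<Prod>\<mu>=1..d. n \<mu>) * n0"
    and "F \<nu> \<equiv> \<lambda>\<mu>. if \<mu> = \<nu> then mat_diag (n \<nu>) (p \<nu>) else 1\<^sub>m (n \<mu>)"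
  assumes A: "\<And>\<nu>. \<nu> \<le> d \<Longrightarrow> A \<nu> \<in> carrier_mat n0 n0"
  shows "kronecker_chain (\<lambda>\<mu>. 1\<^sub>m (n \<mu>)) d (A 0) \<in> carrier_mat N N"
    and "\<nu> \<in> {1..d} \<Longrightarrow> kronecker_chain (F \<nu>) d (A \<nu>) \<in> carrier_mat N N"
  unfolding N_def by (rule kronecker_chain_carrier; use A in \<open>simp add: F_def\<close>)+

lemma affine_operator_entry:
  fixes n :: "nat \<Rightarrow> nat"
  assumes "r < (\<Prod>\<mu>=1..d. n \<mu>) * n0" "c < (\<Prod>\<mu>=1..d. n \<mu>) * n0"
  shows "affine_operator d n p n0 A $$ (r, c) =
    kronecker_chain (\<lambda>\<mu>. 1\<^sub>m (n \<mu>)) d (A 0) $$ (r, c) +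
    (\<Sum>\<nu>\<in>{1..d}. kronecker_chain (\<lambda>\<mu>. if \<mu> = \<nu> then mat_diag (n \<nu>) (p \<nu>) else 1\<^sub>m (n \<mu>)) d (A \<nu>) $$ (r, c))"
  using assms by (simp add: affine_operator_def mat_sum_def)

lemma block_diagonal_affine_operator:
  assumes A: "\<And>\<nu>. \<nu> \<le> d \<Longrightarrow> A \<nu> \<in> carrier_mat n0 n0"
  shows "block_diagonal n0 (affine_operator d n p n0 A)"
proof -
  define F where "F \<nu> = (\<lambda>\<mu>. if \<mu> = \<nu> then mat_diag (n \<nu>) (p \<nu>) else 1\<^sub>m (n \<mu>))" for \<nu>
  note C0 = affine_operator_chain_carrier(1)[where d = d and n = n and A = A, OF A]
  note CF = affine_operator_chain_carrier(2)[where d = d and n = n and p = p and A = A, OF A, folded F_def]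
  have "block_diagonal n0 (kronecker_chain (\<lambda>\<mu>. 1\<^sub>m (n \<mu>)) d (A 0))"
    by (rule block_diagonal_kronecker_chain[where n = n]) (use A in auto)
  moreover have "block_diagonal n0 (kronecker_chain (F \<nu>) d (A \<nu>))" if "\<nu> \<in> {1..d}" for \<nu>
    by (rule block_diagonal_kronecker_chain[where n = n]) (use A that in \<open>auto simp: F_def mat_diag_def\<close>)
  ultimately have "kronecker_chain (\<lambda>\<mu>. 1\<^sub>m (n \<mu>)) d (A 0) $$ (r, c) = 0"
    "\<And>\<nu>. \<nu> \<in> {1..d} \<Longrightarrow> kronecker_chain (F \<nu>) d (A \<nu>) $$ (r, c) = 0"
    if "r < (\<Prod>\<mu>=1..d. n \<mu>) * n0" "c < (\<Prod>\<mu>=1..d. n \<mu>) * n0" "r div n0 \<noteq> c div n0" for r c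
    using that C0 CF unfolding block_diagonal_def by (metis carrier_matD)+
  then have "affine_operator d n p n0 A $$ (r, c) = 0"
    if "r < (\<Prod>\<mu>=1..d. n \<mu>) * n0" "c < (\<Prod>\<mu>=1..d. n \<mu>) * n0" "r div n0 \<noteq> c div n0" for r c
    unfolding affine_operator_entry[OF that(1,2)] F_def[symmetric] using that by simp
  then show ?thesis using affine_operator_carrier[of d A n0 n p] A by (simp add: block_diagonal_def)
qed

text \<open>In the \<open>\<nu>\<close>-th summand all Kronecker factors except one are identities,
  so the product of diagonal entries that scales \<open>A \<nu>\<close> reduces to the single
  parameter value \<open>p \<nu> (i \<nu>)\<close>.\<close>

lemma diag_block_affine_operator:
  assumes A: "\<And>\<nu>. \<nu> \<le> d \<Longrightarrow> A \<nu> \<in> carrier_mat n0 n0"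
    and i: "i \<in> param_indices d n"
  shows "diag_block n0 (block_number d n i) (affine_operator d n p n0 A) =
    affine_at d n0 A (\<lambda>\<nu>. p \<nu> (i \<nu>))"
proof (rule eq_matI)
  define F where "F \<nu> = (\<lambda>\<mu>. if \<mu> = \<nu> then mat_diag (n \<nu>) (p \<nu>) else 1\<^sub>m (n \<mu>))" for \<nu>
  have i: "i \<mu> < n \<mu>" if "\<mu> \<in> {1..d}" for \<mu> using i that by (auto simp: param_indices_def)
  let ?j = "block_number d n i"
  have j: "?j < (\<Prod>\<mu>=1..d. n \<mu>)" by (rule block_number_less[OF i])
  have A0: "A 0 \<in> carrier_mat n0 n0" using A by simp
  fix r c assume "r < dim_row (affine_at d n0 A (\<lambda>\<nu>. p \<nu> (i \<nu>)))"
    "c < dim_col (affine_at d n0 A (\<lambda>\<nu>. p \<nu> (i \<nu>)))"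
  then have rc: "r < n0" "c < n0" using A0 by (auto simp: affine_at_def mat_sum_def)
  note idx = block_index_less[OF j rc(1)] block_index_less[OF j rc(2)]
  have "diag_block n0 ?j (kronecker_chain (\<lambda>\<mu>. 1\<^sub>m (n \<mu>)) d (A 0)) =
      (\<Prod>\<mu>=1..d. 1\<^sub>m (n \<mu>) $$ (i \<mu>, i \<mu>)) \<cdot>\<^sub>m A 0"
    by (rule diag_block_kronecker_chain) (use A i in auto)
  also have "\<dots> = A 0" using i A0 by (auto intro!: eq_matI prod.neutral)
  finally have zero: "kronecker_chain (\<lambda>\<mu>. 1\<^sub>m (n \<mu>)) d (A 0) $$ (?j * n0 + r, ?j * n0 + c) = A 0 $$ (r, c)"
    using rc by (auto simp: diag_block_def dest!: arg_cong[of _ _ "\<lambda>M. M $$ (r, c)"])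
  have summand: "kronecker_chain (F \<nu>) d (A \<nu>) $$ (?j * n0 + r, ?j * n0 + c) = p \<nu> (i \<nu>) * A \<nu> $$ (r, c)"
    if \<nu>: "\<nu> \<in> {1..d}" for \<nu>
  proof -
    have "diag_block n0 ?j (kronecker_chain (F \<nu>) d (A \<nu>)) =
        (\<Prod>\<mu>=1..d. F \<nu> \<mu> $$ (i \<mu>, i \<mu>)) \<cdot>\<^sub>m A \<nu>"
      by (rule diag_block_kronecker_chain) (use A i \<nu> in \<open>auto simp: F_def\<close>)
    also have "(\<Prod>\<mu>=1..d. F \<nu> \<mu> $$ (i \<mu>, i \<mu>)) = (\<Prod>\<mu>\<in>{1..d}. if \<mu> = \<nu> then p \<nu> (i \<nu>) else 1)"
      using i by (intro prod.cong) (auto simp: F_def mat_diag_def)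
    also have "\<dots> = p \<nu> (i \<nu>)" using \<nu> by simp
    finally show ?thesis
      using rc A[of \<nu>] \<nu> by (auto simp: diag_block_def dest!: arg_cong[of _ _ "\<lambda>M. M $$ (r, c)"])
  qed
  show "diag_block n0 ?j (affine_operator d n p n0 A) $$ (r, c) =
      affine_at d n0 A (\<lambda>\<nu>. p \<nu> (i \<nu>)) $$ (r, c)"
  proof -
    have "affine_operator d n p n0 A $$ (?j * n0 + r, ?j * n0 + c) =
        A 0 $$ (r, c) + (\<Sum>\<nu>\<in>{1..d}. p \<nu> (i \<nu>) * A \<nu> $$ (r, c))"
      unfolding affine_operator_entry[OF idx] F_def[symmetric] using zero summand by simp
    then show ?thesis
      using rc A0 A by (simp add: diag_block_def affine_at_def mat_sum_def carrier_matD[OF A])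
  qed
qed (use A[of 0] in \<open>auto simp: affine_at_def mat_sum_def diag_block_def\<close>)

section \<open>Exponential sums of diagonal matrices and spectral radii\<close>

lemma mat_diag_pow:
  fixes f :: "nat \<Rightarrow> 'a :: comm_semiring_1"
  shows "mat_diag n f ^\<^sub>m k = mat_diag n (\<lambda>i. f i ^ k)"
proof (induction k)
  case 0
  have "dim_row (mat_diag n f) = n" by (simp add: mat_diag_def)
  then show ?case by simp
next
  case (Suc k)
  then show ?case by (simp add: mult.commute)
qed

lemma mat_exp_mat_diag: "mat_exp (mat_diag n f) = mat_diag n (\<lambda>i. exp (f i))"
proof (rule eq_matI)
  fix r c assume "r < dim_row (mat_diag n (\<lambda>i. exp (f i)))" "c < dim_col (mat_diag n (\<lambda>i. exp (f i)))"
  then have rc: "r < n" "c < n" by (auto simp: mat_diag_def)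
  then have "mat_exp (mat_diag n f) $$ (r, c) = (\<Sum>j. (if r = c then f c ^ j else 0) / fact j)"
    by (simp add: mat_exp_def mat_diag_pow) (simp add: mat_diag_def)
  also have "\<dots> = (if r = c then exp (f c) else 0)"
    by (simp add: exp_def scaleR_conv_of_real divide_inverse mult.commute)
  finally show "mat_exp (mat_diag n f) $$ (r, c) = mat_diag n (\<lambda>i. exp (f i)) $$ (r, c)"
    using rc by (simp add: mat_diag_def)
qed (auto simp: mat_exp_def mat_diag_def)

lemma exp_sum_mat_mat_diag:
  "exp_sum_mat k \<alpha> \<beta> (mat_diag n f) = mat_diag n (\<lambda>i. exp_sum k \<alpha> \<beta> (f i))"
proof -
  have smult: "c \<cdot>\<^sub>m mat_diag n f = mat_diag n (\<lambda>i. c * f i)" for c and f :: "nat \<Rightarrow> real"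
    by (rule eq_matI) (auto simp: mat_diag_def)
  have "mat_sum n (\<lambda>m. mat_diag n (F m)) I = mat_diag n (\<lambda>i. \<Sum>m\<in>I. F m i)" for F and I :: "nat set"
    by (rule eq_matI) (auto simp: mat_sum_def mat_diag_def)
  moreover have "dim_row (mat_diag n f) = n" by (simp add: mat_diag_def)
  ultimately show ?thesis
    by (simp add: exp_sum_mat_def smult mat_exp_mat_diag exp_sum_def)
qed

text \<open>Unit vectors are eigenvectors of the diagonal part. This turns the spectral inclusions
  into bounds on the diagonal entries.\<close>

lemma diag_entry_mem_real_spectrum:
  assumes i: "i < dim_row M"
  shows "complex_of_real (M $$ (i, i)) \<in> real_spectrum (diag_part M)"
proof -
  define n where "n = dim_row M"
  let ?D = "map_mat complex_of_real (diag_part M)"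
  let ?e = "unit_vec n i :: complex vec"
  have i: "i < n" using i by (simp add: n_def)
  have D: "?D \<in> carrier_mat n n" by (simp add: diag_part_def n_def mat_diag_def)
  have "?D *\<^sub>v ?e = complex_of_real (M $$ (i, i)) \<cdot>\<^sub>v ?e"
    using D i by (intro eq_vecI) (auto simp: diag_part_def mat_diag_def n_def)
  moreover have "?e \<noteq> 0\<^sub>v n" using i by (auto simp: vec_eq_iff)
  ultimately have "eigenvector ?D ?e (complex_of_real (M $$ (i, i)))"
    using D by (auto simp: eigenvector_def)
  then show ?thesis by (auto simp: real_spectrum_def spectrum_def eigenvalue_def)
qed

text \<open>Dividing an eigenvalue of \<open>\<omega> M\<close> by \<open>\<omega>\<close> gives one
  of \<open>M\<close>, so the scaled matrix has spectral radius below 1 and its complex powers are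
  bounded. The embedding of the reals preserves absolute values and commutes with powers, so the
  bound descends to the real matrix.\<close>

lemma real_powers_bounded:
  assumes M: "M \<in> carrier_mat n n" and n: "0 < n" and \<omega>: "0 < \<omega>"
    and lt: "\<omega> * real_spectral_radius M < 1"
  shows "\<exists>c. \<forall>k. norm_bound ((\<omega> \<cdot>\<^sub>m M) ^\<^sub>m k) c"
proof -
  let ?C = "map_mat complex_of_real"
  have C: "?C M \<in> carrier_mat n n" "?C (\<omega> \<cdot>\<^sub>m M) \<in> carrier_mat n n" using M by auto
  have smult: "?C (\<omega> \<cdot>\<^sub>m M) = complex_of_real \<omega> \<cdot>\<^sub>m ?C M" by (rule eq_matI) auto
  obtain ev v where ev: "spectral_radius (?C (\<omega> \<cdot>\<^sub>m M)) = norm ev" "eigenvector (?C (\<omega> \<cdot>\<^sub>m M)) v ev"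
    using spectral_radius_mem_max(1)[OF C(2) n] by (auto simp: spectrum_def eigenvalue_def)
  have v: "v \<in> carrier_vec n" "v \<noteq> 0\<^sub>v n" "?C (\<omega> \<cdot>\<^sub>m M) *\<^sub>v v = ev \<cdot>\<^sub>v v"
    using ev(2) M by (auto simp: eigenvector_def)
  have "?C M *\<^sub>v v = (ev / complex_of_real \<omega>) \<cdot>\<^sub>v v"
  proof (rule eq_vecI)
    fix i assume "i < dim_vec ((ev / complex_of_real \<omega>) \<cdot>\<^sub>v v)"
    then have i: "i < n" using v by simp
    have "(complex_of_real \<omega> \<cdot>\<^sub>v (?C M *\<^sub>v v)) $ i = (ev \<cdot>\<^sub>v v) $ i"
      using v(3) C v(1) unfolding smult by (simp add: smult_mat_mult_vec[of _ n n])
    then show "(?C M *\<^sub>v v) $ i = ((ev / complex_of_real \<omega>) \<cdot>\<^sub>v v) $ i"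
      using i v(1) M \<omega> by (simp add: field_simps)
  qed (use v M in auto)
  then have "eigenvector (?C M) v (ev / complex_of_real \<omega>)"
    using v M by (simp add: eigenvector_def)
  then have "norm (ev / complex_of_real \<omega>) \<le> real_spectral_radius M"
    unfolding real_spectral_radius_def
    by (intro spectral_radius_mem_max(2)[OF C(1) n] imageI) (auto simp: spectrum_def eigenvalue_def)
  then have "norm ev \<le> \<omega> * real_spectral_radius M"
    using \<omega> by (simp add: norm_divide field_simps)
  then have "spectral_radius (?C (\<omega> \<cdot>\<^sub>m M)) < 1" using lt ev by simp
  from spectral_radius_jnf_norm_bound_less_1_upper_triangular[OF C(2) this]
  obtain c where c: "norm_bound (?C (\<omega> \<cdot>\<^sub>m M) ^\<^sub>m k) c" for k by blast
  have "norm_bound ((\<omega> \<cdot>\<^sub>m M) ^\<^sub>m k) c" for k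
  proof -
    have eq: "?C ((\<omega> \<cdot>\<^sub>m M) ^\<^sub>m k) = ?C (\<omega> \<cdot>\<^sub>m M) ^\<^sub>m k"
      by (rule of_real_hom.mat_hom_pow) (use M in auto)
    show ?thesis
      using c[of k] unfolding eq[symmetric] norm_bound_def
      by (metis index_map_mat norm_of_real real_norm_def)
  qed
  then show ?thesis by blast
qed

lemma sym_pos_def_pos_semidef: "sym_pos_def n A \<Longrightarrow> pos_semidef n A"
  unfolding pos_semidef_def
proof
  fix v :: "real vec" assume *: "sym_pos_def n A" "v \<in> carrier_vec n"
  then show "0 \<le> v \<bullet> (A *\<^sub>v v)"
    by (cases "v = 0\<^sub>v n") (auto simp: sym_pos_def_def less_imp_le)
qed

lemma norm_bound_diag_block:
  assumes "norm_bound M c" "M \<in> carrier_mat (K * n0) (K * n0)" "j < K"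
  shows "norm_bound (diag_block n0 j M) c"
  using assms block_index_less[OF assms(3)] by (auto simp: norm_bound_def diag_block_def)

section \<open>Level-independent constants and transfer to the blocks\<close>

theorem theorem4p17:
  fixes d :: nat
    and n :: "nat \<Rightarrow> nat"
    and p :: "nat \<Rightarrow> nat \<Rightarrow> real"
    and h :: "nat \<Rightarrow> real"
    and n0 :: "nat \<Rightarrow> nat"
    and A :: "nat \<Rightarrow> nat \<Rightarrow> real mat"
    and a :: real and b :: ereal
    and k :: nat and \<alpha> \<beta> :: "nat \<Rightarrow> real"
    and \<omega> :: real
  assumes "\<And>l. h l > 0"
    and "\<And>\<nu>. \<nu> \<in> {1..d} \<Longrightarrow> n \<nu> > 0"
    and "\<And>l. n0 l > 0"
    and "\<And>l \<nu>. \<nu> \<le> d \<Longrightarrow> A l \<nu> \<in> carrier_mat (n0 l) (n0 l)"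
    and "\<And>l i. i \<in> param_indices d n \<Longrightarrow>
           sym_pos_def (n0 l) (affine_at d (n0 l) (A l) (\<lambda>\<nu>. p \<nu> (i \<nu>)))"
    and "0 < a" and "ereal a < b"
    and "\<And>l. real_spectrum (diag_part (affine_operator d n p (n0 l) (A l)))
           \<subseteq> complex_of_real ` interval_upto a b"
    and "b = \<infinity> \<Longrightarrow>
           \<exists>M. \<forall>l. real_spectrum (diag_part (affine_operator d n p (n0 l) (A l)))
             \<subseteq> complex_of_real ` {a..M}"
    and "\<And>l \<nu>. \<nu> \<in> {1..d} \<Longrightarrow>
           \<exists>c e. c > 0 \<and> (\<forall>r < n0 l. e r \<in> {0, 1}) \<and>
             diag_part (A l \<nu>) = c \<cdot>\<^sub>m mat_diag (n0 l) e"
    and "k \<ge> 1"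
    and "exp_sum_weights k a b \<alpha> \<beta>"
    and "0 < \<omega>"
    and "\<And>l. \<omega> < damping_bound k \<alpha> \<beta> (affine_operator d n p (n0 l) (A l))"
  shows "smoothing_property h (param_indices d n)
           (\<lambda>l i. affine_at d (n0 l) (A l) (\<lambda>\<nu>. p \<nu> (i \<nu>)))
           (\<lambda>l. param_block d n (n0 l)
              (approx_jacobi k \<alpha> \<beta> \<omega> (affine_operator d n p (n0 l) (A l))))"
proof -
  define P where "P = (\<Prod>\<mu>=1..d. n \<mu>)"
  define L where "L l = affine_operator d n p (n0 l) (A l)" for l
  define B where "B l i = affine_at d (n0 l) (A l) (\<lambda>\<nu>. p \<nu> (i \<nu>))" for l i
  have P: "0 < P" using assms(2) unfolding P_def by (intro prod_pos) auto
  have L: "L l \<in> carrier_mat (P * n0 l) (P * n0 l)" for l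
    unfolding L_def P_def by (rule affine_operator_carrier) (rule assms(4))
  have Lblock: "block_diagonal (n0 l) (L l)" for l
    unfolding L_def by (rule block_diagonal_affine_operator) (rule assms(4))
  \<comment> \<open>For finite \<open>b\<close> the common bound is \<open>b\<close> itself, for
    \<open>b = \<infinity>\<close> it is assumed. Without it, diagonal entries could grow with the
    level and the exponentially decaying weights could tend to 0.\<close>
  have "\<exists>M. \<forall>l. real_spectrum (diag_part (L l)) \<subseteq> complex_of_real ` {a..M}"
  proof (cases b)
    case (real M)
    then have "interval_upto a b = {a..M}" by (auto simp: interval_upto_def)
    then show ?thesis using assms(8) by (auto simp: L_def)
  qed (use assms(7,9) L_def in auto)
  then obtain M where M: "real_spectrum (diag_part (L l)) \<subseteq> complex_of_real ` {a..M}" for l by blast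
  have diag: "a \<le> L l $$ (r, r)" "L l $$ (r, r) \<le> M" if "r < P * n0 l" for l r
    using M[of l] diag_entry_mem_real_spectrum[of r "L l"] that L[of l] by auto
  have weights: "0 < \<alpha> m" "0 < \<beta> m" if "m \<in> {1..k}" for m
    using assms(6,12) that by (auto simp: exp_sum_weights_def best_exp_sum_def pos_weights_def)
  define w where "w l r = exp_sum k \<alpha> \<beta> (L l $$ (r, r))" for l r
  \<comment> \<open>An exponential sum with positive weights is decreasing, so its value at the
    largest admissible diagonal entry is a lower bound on all levels.\<close>
  define w0 where "w0 = exp_sum k \<alpha> \<beta> M"
  have w0: "0 < w0" unfolding w0_def exp_sum_def
    using assms(11) weights by (intro sum_pos) auto
  have w: "w0 \<le> w l r" if "r < P * n0 l" for l r
    unfolding w0_def w_def exp_sum_def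
    by (intro sum_mono mult_left_mono) (use weights diag[OF that] in \<open>auto simp: less_imp_le\<close>)
  define T where "T l = mat_diag (P * n0 l) (w l) * L l" for l
  have T: "T l \<in> carrier_mat (P * n0 l) (P * n0 l)" for l
    using L unfolding T_def by (intro mult_carrier_mat[OF mat_diag_dim])
  have T_eq: "exp_sum_mat k \<alpha> \<beta> (diag_part (L l)) * L l = T l" for l
    using L[of l] by (simp add: diag_part_def exp_sum_mat_mat_diag T_def w_def[abs_def])
  have jac: "approx_jacobi k \<alpha> \<beta> \<omega> (L l) = 1\<^sub>m (P * n0 l) - \<omega> \<cdot>\<^sub>m T l" for l
    using L[of l] by (simp add: approx_jacobi_def T_eq)
  have "\<omega> * real_spectral_radius (T l) < 1" for l
  proof -
    have *: "\<omega> < 1 / real_spectral_radius (T l)"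
      using assms(14)[of l] by (simp add: damping_bound_def T_eq flip: L_def)
    \<comment> \<open>As \<open>1 / 0 = 0\<close>, a vanishing radius would make the damping bound
      0, which \<open>0 < \<omega>\<close> excludes.\<close>
    then have "0 < real_spectral_radius (T l)"
      using assms(13) by (metis less_trans zero_less_divide_1_iff)
    then show ?thesis using * by (simp add: pos_less_divide_eq)
  qed
  then have bounded: "\<exists>c. \<forall>j. norm_bound ((\<omega> \<cdot>\<^sub>m T l) ^\<^sub>m j) c" for l
    by (intro real_powers_bounded[OF T]) (use P assms(3,13) in auto)
  define \<eta> where "\<eta> m = 1 / (w0 * \<omega> * a) * inverse (real (Suc m))" for m
  have "spectral_norm (B l i * param_block d n (n0 l) (approx_jacobi k \<alpha> \<beta> \<omega> (L l)) i ^\<^sub>m m)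
      \<le> \<eta> m * spectral_norm (B l i)" if i: "i \<in> param_indices d n" for l i m
  proof -
    define j where "j = block_number d n i"
    define u where "u r = w l (j * n0 l + r)" for r
    have j: "j < P" unfolding j_def P_def
      by (rule block_number_less) (use i in \<open>auto simp: param_indices_def\<close>)
    have B_eq: "diag_block (n0 l) j (L l) = B l i"
      unfolding L_def B_def j_def by (rule diag_block_affine_operator[OF assms(4) i])
    have B: "B l i \<in> carrier_mat (n0 l) (n0 l)" "transpose_mat (B l i) = B l i"
      "pos_semidef (n0 l) (B l i)"
      using assms(5)[OF i, of l] sym_pos_def_pos_semidef by (auto simp: B_def sym_pos_def_def)
    have T_block: "diag_block (n0 l) j (\<omega> \<cdot>\<^sub>m T l) = \<omega> \<cdot>\<^sub>m (mat_diag (dim_row (B l i)) u * B l i)"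
      using B(1) diag_block_smult[OF T j] diag_block_mat_diag_mult[OF L j, where f = "w l"]
      by (simp add: T_def B_eq u_def[abs_def])
    have jac_block: "param_block d n (n0 l) (approx_jacobi k \<alpha> \<beta> \<omega> (L l)) i =
        1\<^sub>m (n0 l) - \<omega> \<cdot>\<^sub>m (mat_diag (dim_row (B l i)) u * B l i)"
      unfolding param_block_eq_diag_block jac j_def[symmetric] T_block[symmetric]
      using T[of l] j by (simp add: diag_block_minus[of _ P] diag_block_one)
    obtain c where c: "norm_bound ((\<omega> \<cdot>\<^sub>m T l) ^\<^sub>m q) c" for q using bounded by blast
    have "block_diagonal (n0 l) (T l)"
      unfolding T_def by (rule block_diagonal_mat_diag_mult[OF L Lblock])
    then have Tblock: "block_diagonal (n0 l) (\<omega> \<cdot>\<^sub>m T l)" by (auto simp: block_diagonal_def)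
    \<comment> \<open>The damping condition is exploited for the whole operator only: a block of a
      power is the power of the block, and its entries are among those already bounded.\<close>
    have cblock: "norm_bound ((\<omega> \<cdot>\<^sub>m (mat_diag (dim_row (B l i)) u * B l i)) ^\<^sub>m q) c" for q
      unfolding T_block[symmetric] diag_block_pow[OF smult_carrier_mat[OF T] Tblock j, symmetric]
      by (rule norm_bound_diag_block[OF c _ j]) (use T in simp)
    have low: "w0 \<le> u r" if "r < n0 l" for r
      unfolding u_def by (rule w[OF block_index_less[OF j that]])
    have "spectral_norm (B l i * (1\<^sub>m (n0 l) - \<omega> \<cdot>\<^sub>m (mat_diag (dim_row (B l i)) u * B l i)) ^\<^sub>m m)
        \<le> 1 / (w0 * \<omega> * real (Suc m))"
    proof (rule spectral_norm_leI[OF _ assms(3)])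
      have "dim_row (B l i) = n0 l" using B by simp
      then show "B l i * (1\<^sub>m (n0 l) - \<omega> \<cdot>\<^sub>m (mat_diag (dim_row (B l i)) u * B l i)) ^\<^sub>m m
          \<in> carrier_mat (n0 l) (n0 l)"
        using mult_carrier_mat[OF B(1) pow_carrier_mat[OF minus_carrier_mat[OF
              smult_carrier_mat[OF mult_carrier_mat[OF mat_diag_dim B(1)]]]]] by metis
    qed (rule weighted_jacobi_smoothing[OF B w0 low assms(13) cblock])
    also have "\<dots> = \<eta> m * a" using assms(6) by (simp add: \<eta>_def field_split_simps del: of_nat_Suc)
    also have "\<dots> \<le> \<eta> m * spectral_norm (B l i)"
    proof (rule mult_left_mono)
      \<comment> \<open>Any diagonal entry of the block would do; the first one exists since
        \<open>n0 l > 0\<close>. The \<open>+ 0\<close> keeps the shape of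
        \<open>block_index_less\<close>.\<close>
      have "a \<le> L l $$ (j * n0 l + 0, j * n0 l + 0)"
        by (rule diag(1)[OF block_index_less[OF j assms(3)]])
      also have "\<dots> = B l i $$ (0, 0)"
        unfolding B_eq[symmetric] using assms(3)[of l] by (simp add: diag_block_def)
      also have "\<dots> \<le> spectral_norm (B l i)"
        by (rule entry_le_spectral_norm[OF B(1) assms(3) assms(3)])
      finally show "a \<le> spectral_norm (B l i)" .
      show "0 \<le> \<eta> m" using w0 assms(6,13) by (simp add: \<eta>_def)
    qed
    finally show ?thesis by (simp add: jac_block)
  qed
  moreover have "\<eta> \<longlonglongrightarrow> 0"
    unfolding \<eta>_def by (rule tendsto_mult_right_zero[OF LIMSEQ_inverse_real_of_nat])
  ultimately show ?thesis
    unfolding smoothing_property_def B_def[symmetric] L_def[symmetric]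
    by (intro exI[of _ \<eta>] exI[of _ "\<lambda>_. \<infinity>"]) auto
qed

end
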